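(* Let $1\le p<\infty$, $a\ge b\ge 0$, and $\sigma>0$. For every function $f\in L^{p}(|x|^{2a})=L^{p}(\mathbb{R},|x|^{2a}\,dx)$ one has \[ \lim_{n\to\infty}\Bigl(\frac{n}{\sigma}\Bigr)^{(2a+1)/p}E_{n,\sigma}(f)_{p,a,b}=A_{\sigma}(f)_{p,a}, \] where $n$ runs over the positive integers.
   Context: Here $p,a,b,\sigma$ are real numbers and functions are complex-valued. The periodic Jacobi weight is \[ w_{a,b}(t)=\Bigl|2\sin\frac{t}{2}\Bigr|^{2a}\Bigl|\cos\frac{t}{2}\Bigr|^{2b},\quad t\in\mathbb{R}. \] $\mathcal{T}_{n}$ denotes the space of $2\pi$-periodic trigonometric polynomials of degree at most $n$. $\mathcal{E}_{\sigma}$ denotes the class of entire functions of exponential type at most $\sigma$, and $\mathcal{E}_{\sigma,p,a}=\mathcal{E}_{\sigma}\cap L^{p}(\mathbb{R},|x|^{2a}\,dx)$ is the set of $F\in\mathcal{E}_\sigma$ whose restriction to $\mathbb{R}$ lies in $L^{p}(\mathbb{R},|x|^{2a}\,dx)$. For $n\in\mathbb{N}$ (positive integers) and $\sigma>0$, the error of periodic approximation is \[ E_{n,\sigma}(f)_{p,a,b}=\inf_{T\in\mathcal{T}_{n}}\biggl(\int_{-\pi}^{\pi}\Bigl|f\Bigl(\frac{n}{\sigma}\,t\Bigr)-T(t)\Bigr|^{p}w_{a,b}(t)\,dt\biggr)^{1/p}, \] and the error on the line is \[ A_{\sigma}(f)_{p,a}=\inf_{F\in\mathcal{E}_{\sigma,p,a}}\biggl(\int_{\mathbb{R}}|f(x)-F(x)|^{p}|x|^{2a}\,dx\biggr)^{1/p}.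 \] *)

theory Defs
  imports "HOL-Complex_Analysis.Complex_Analysis"
begin

text \<open>
  Powers with real exponent are written with \<open>powr\<close>. Since \<open>0 powr 0 = 0\<close>, the weights below
  vanish (instead of being 1) at the zeros of their base when the exponent is 0. This affects
  only null sets, hence none of the integrals.
\<close>

definition jacobi_weight :: "real \<Rightarrow> real \<Rightarrow> real \<Rightarrow> real" where
  "jacobi_weight a b t = \<bar>2 * sin (t / 2)\<bar> powr (2 * a) * \<bar>cos (t / 2)\<bar> powr (2 * b)"

definition power_weight :: "real \<Rightarrow> real \<Rightarrow> real" where
  "power_weight a x = \<bar>x\<bar> powr (2 * a)"

definition trig_polys :: "nat \<Rightarrow> (real \<Rightarrow> complex) set" where
  "trig_polys n = {T. \<exists>c :: int \<Rightarrow> complex.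
     \<forall>t. T t = (\<Sum>k\<in>{- int n..int n}. c k * exp (\<i> * of_int k * of_real t))}"

definition exp_type_le :: "real \<Rightarrow> (complex \<Rightarrow> complex) set" where
  "exp_type_le \<sigma> = {F. F holomorphic_on UNIV \<and>
     (\<forall>\<epsilon>>0. \<exists>C. \<forall>z. norm (F z) \<le> C * exp ((\<sigma> + \<epsilon>) * norm z))}"

definition Lp_power :: "real \<Rightarrow> real \<Rightarrow> (real \<Rightarrow> complex) set" where
  "Lp_power p a = {g. g \<in> borel_measurable lebesgue \<and>
     integrable lebesgue (\<lambda>x. norm (g x) powr p * power_weight a x)}"

definition exp_type_Lp :: "real \<Rightarrow> real \<Rightarrow> real \<Rightarrow> (complex \<Rightarrow> complex) set" where
  "exp_type_Lp \<sigma> p a = {F \<in> exp_type_le \<sigma>. (\<lambda>x. F (of_real x)) \<in> Lp_power p a}"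

text \<open>
  Both infima are taken in the reals, over nonempty sets of nonnegative numbers. For
  \<open>f \<in> Lp_power p a\<close> with \<open>p \<ge> 1\<close> and \<open>a, b \<ge> 0\<close> all integrands below are
  integrable (the Jacobi weight is bounded, and bounded by a multiple of the power weight), so
  the convention that the integral of a nonintegrable function is 0 never applies.
\<close>

definition periodic_error ::
  "nat \<Rightarrow> real \<Rightarrow> (real \<Rightarrow> complex) \<Rightarrow> real \<Rightarrow> real \<Rightarrow> real \<Rightarrow> real" where
  "periodic_error n \<sigma> f p a b = (INF T\<in>trig_polys n.
     (LINT t:{-pi..pi}|lebesgue. norm (f (real n / \<sigma> * t) - T t) powr p * jacobi_weight a b t)
       powr (1 / p))"

definition line_error :: "real \<Rightarrow> (real \<Rightarrow> complex) \<Rightarrow> real \<Rightarrow> real \<Rightarrow> real" where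
  "line_error \<sigma> f p a = (INF F\<in>exp_type_Lp \<sigma> p a.
     (LINT x|lebesgue. norm (f x - F (of_real x)) powr p * power_weight a x) powr (1 / p))"

end

theory Submission
  imports Defs "HOL-Real_Asymp.Real_Asymp"
begin

text \<open>
  Put \<open>r = n / \<sigma>\<close> and substitute \<open>x = r t\<close>. The periodic problem, multiplied by
  \<open>r powr ((2 * a + 1) / p)\<close>, becomes the approximation of \<open>f\<close> on \<open>[- pi r, pi r]\<close> by
  the functions \<open>T (x / r)\<close>, which are restrictions of entire functions of exponential type at most
  \<open>\<sigma>\<close> and have period \<open>2 pi r\<close>. The rescaled weights are dominated by \<open>\<bar>x\<bar> powr (2 * a)\<close> and
  converge to it as \<open>r\<close> grows, so the periodic problems turn into the problem on the line.
  Two inequalities make this rigorous.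

  The limit is at most the error on the line. Let \<open>F\<close> be a competitor on the line. A
  Phragmen--Lindelof argument shows that \<open>F\<close> is bounded on the real axis and of growth
  \<open>exp ((\<sigma> + \<epsilon>) * \<bar>Im z\<bar>)\<close> (\<open>exp_type_Lp_growth\<close>). A slight dilation of \<open>F\<close>, multiplied by a
  power of the sinc function, is again of type \<open>\<sigma>\<close>, decays like any prescribed power, and has nearly
  the same distance from \<open>f\<close> (\<open>damped_dilation_error_tendsto\<close>). The sum \<open>\<Sum>j. G (x + 2 pi r j)\<close>
  of the translates of such a function \<open>G\<close> is a trigonometric polynomial of degree at most \<open>n\<close> in
  \<open>t\<close> (\<open>periodization_trig_poly\<close>), because an entire function of period \<open>2 pi\<close> and growth
  \<open>exp (n * \<bar>Im z\<bar>)\<close> is a Laurent polynomial in \<open>exp (\<i> z)\<close>. It converges to \<open>G\<close>, dominated by the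
  decay of \<open>G\<close>, so its error tends to the distance between \<open>f\<close> and \<open>G\<close>.

  The limit is at least the error on the line. Let \<open>T i\<close> be trigonometric polynomials of degrees
  \<open>s i \<rightarrow> \<infinity>\<close> whose rescaled errors stay below \<open>R\<close>. The rescaled integrals of \<open>\<bar>T i\<bar> powr p\<close>
  are then bounded, and the weighted Nikolskii inequality (\<open>weighted_nikolskii\<close>) turns this into a
  bound on the maximum of \<open>\<bar>T i\<bar>\<close>; here \<open>b \<le> a\<close> ensures that the weight near \<open>\<plusminus> pi\<close> is not smaller
  than near \<open>0\<close>. Hence the rescaled polynomials are uniformly bounded by \<open>M * exp (\<sigma> * \<bar>Im z\<bar>)\<close>, by
  Montel's theorem a subsequence converges to an entire function of type \<open>\<sigma>\<close>, and by Fatou's lemma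
  the error of the limit is at most \<open>R\<close> (\<open>exp_type_limit_of_trig_polys\<close>).
\<close>

section \<open>Trigonometric polynomials as entire functions\<close>

definition trig_sum :: "(int \<Rightarrow> complex) \<Rightarrow> nat \<Rightarrow> complex \<Rightarrow> complex" where
  "trig_sum c n z = (\<Sum>k\<in>{- int n..int n}. c k * exp (\<i> * of_int k * z))"

lemma trig_polys_iff: "T \<in> trig_polys n \<longleftrightarrow> (\<exists>c. T = (\<lambda>t. trig_sum c n (of_real t)))"
  unfolding trig_polys_def trig_sum_def by auto

lemma trig_sum_holomorphic: "trig_sum c n holomorphic_on A"
  unfolding trig_sum_def by (intro holomorphic_intros)

lemma trig_sum_reflect: "trig_sum (\<lambda>k. c (- k)) n (- z) = trig_sum c n z"
  unfolding trig_sum_def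
  by (rule sum.reindex_bij_witness[of _ uminus uminus]) auto

lemma trig_sum_periodic: "trig_sum c n (z + 2 * of_real pi) = trig_sum c n z"
proof -
  have "exp (\<i> * of_int k * (z + 2 * of_real pi)) = exp (\<i> * of_int k * z)" for k
  proof -
    have "\<i> * of_int k * (z + 2 * of_real pi) = \<i> * of_int k * z + of_int k * (of_real (2 * pi) * \<i>)"
      by (simp add: algebra_simps)
    then show ?thesis
      using exp_eq[of "\<i> * of_int k * (z + 2 * of_real pi)" "\<i> * of_int k * z"]
      by (auto simp: algebra_simps intro!: exI[of _ k])
  qed
  then show ?thesis unfolding trig_sum_def by simp
qed

text \<open>
  In the upper half-plane \<open>exp (\<i> * n * z)\<close> times the polynomial is an ordinary polynomial in
  \<open>w = exp (\<i> * z)\<close> with \<open>\<bar>w\<bar> \<le> 1\<close>; the real axis corresponds to the unit circle, so the maximum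
  principle in the disc gives the bound.
\<close>

lemma trig_sum_growth_upper:
  assumes M: "\<And>t::real. norm (trig_sum c n (of_real t)) \<le> M" and z: "Im z \<ge> 0"
  shows "norm (trig_sum c n z) \<le> M * exp (real n * Im z)"
proof -
  define Q where "Q = (\<lambda>w::complex. \<Sum>k\<in>{- int n..int n}. c k * w ^ nat (k + int n))"
  have Q: "Q (exp (\<i> * y)) = exp (\<i> * of_nat n * y) * trig_sum c n y" for y
  proof -
    have "exp (\<i> * y) ^ nat (k + int n) = exp (\<i> * of_nat n * y) * exp (\<i> * of_int k * y)"
      if "k \<in> {- int n..int n}" for k
    proof -
      have "exp (\<i> * y) ^ nat (k + int n) = exp (of_nat (nat (k + int n)) * (\<i> * y))"
        by (simp add: exp_of_nat_mult)
      also have "of_nat (nat (k + int n)) = (of_int (k + int n) :: complex)"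
        using that by (subst of_nat_nat) auto
      finally show ?thesis by (simp add: exp_add[symmetric] algebra_simps)
    qed
    then show ?thesis unfolding Q_def trig_sum_def by (simp add: sum_distrib_left algebra_simps)
  qed
  have "norm (Q (exp (\<i> * z))) \<le> M"
  proof (rule maximum_modulus_frontier[of Q "cball 0 1"])
    show "Q holomorphic_on interior (cball 0 1)" "continuous_on (closure (cball 0 1)) Q"
      unfolding Q_def by (intro holomorphic_intros continuous_intros)+
    fix w :: complex assume "w \<in> frontier (cball 0 1)"
    then have "norm w = 1" by simp
    then obtain t where "w = exp (\<i> * of_real t)"
      using complex_norm_eq_1_exp_eq[of w] by metis
    then show "norm (Q w) \<le> M" using Q[of "of_real t"] M[of t] by (simp add: norm_mult norm_exp_eq_Re)
  qed (use z in auto)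
  then have "exp (- (real n * Im z)) * norm (trig_sum c n z) \<le> M"
    by (simp add: Q norm_mult norm_exp_eq_Re)
  then show ?thesis by (simp add: exp_minus field_simps)
qed

lemma trig_sum_growth:
  assumes M: "\<And>t::real. norm (trig_sum c n (of_real t)) \<le> M"
  shows "norm (trig_sum c n z) \<le> M * exp (real n * \<bar>Im z\<bar>)"
proof (cases "Im z \<ge> 0")
  case True
  then show ?thesis using trig_sum_growth_upper[OF M True] by simp
next
  case False
  have "norm (trig_sum (\<lambda>k. c (- k)) n (of_real t)) \<le> M" for t
    using M[of "-t"] trig_sum_reflect[of c n "- of_real t"] by simp
  from trig_sum_growth_upper[OF this, of "-z"] show ?thesis
    using False by (simp add: trig_sum_reflect)
qed

lemma periodic_eq_of_exp_eq:
  fixes U :: "complex \<Rightarrow> complex"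
  assumes per: "\<And>z. U (z + 2 * of_real pi) = U z" and eq: "exp (\<i> * y) = exp (\<i> * z)"
  shows "U y = U z"
proof -
  have per_nat: "U (z + of_nat m * (2 * of_real pi)) = U z" for z m
    using per[of "z + of_nat k * (2 * of_real pi)" for k]
    by (induction m) (simp_all add: algebra_simps)
  have per_int: "U (z + of_int k * (2 * of_real pi)) = U z" for z k
  proof (cases k)
    case (neg m)
    have "z + of_int k * (2 * of_real pi) + of_nat (Suc m) * (2 * of_real pi) = z"
      by (simp add: neg) (simp add: algebra_simps)
    then show ?thesis using per_nat[of "z + of_int k * (2 * of_real pi)" "Suc m"] by metis
  qed (use per_nat in simp)
  obtain k :: int where "\<i> * y = \<i> * z + (of_int (2 * k) * pi) * \<i>"
    using iffD1[OF exp_eq eq] by blast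
  then have "\<i> * y = \<i> * (z + of_int k * (2 * of_real pi))" by (simp add: algebra_simps)
  then have "y = z + of_int k * (2 * of_real pi)" by simp
  then show ?thesis by (simp add: per_int)
qed

text \<open>
  In the variable \<open>w = exp (\<i> * z)\<close> the function \<open>exp (\<i> * n * z) * U z\<close> is holomorphic in the
  punctured plane. The growth condition makes it bounded near \<open>0\<close> and \<open>O(\<bar>w\<bar> ^ (2 * n))\<close> at infinity,
  hence it is a polynomial of degree at most \<open>2 * n\<close> by Riemann's and Liouville's theorems.
\<close>

lemma entire_periodic_imp_trig_poly:
  fixes U :: "complex \<Rightarrow> complex"
  assumes hol: "U holomorphic_on UNIV"
    and per: "\<And>z. U (z + 2 * of_real pi) = U z"
    and growth: "\<And>z. norm (U z) \<le> C * exp (real n * \<bar>Im z\<bar>)"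
  shows "(\<lambda>t. U (of_real t)) \<in> trig_polys n"
proof -
  note per_exp = periodic_eq_of_exp_eq[of U, OF per]
  define P where "P = (\<lambda>w. w ^ n * U (- \<i> * Ln w))"
  have P_exp: "P (exp (\<i> * z)) = exp (\<i> * z) ^ n * U z" for z
    unfolding P_def using per_exp[of "- \<i> * Ln (exp (\<i> * z))" z] by simp
  have C0: "C \<ge> 0" using growth[of 0] by (simp add: order_trans[OF norm_ge_zero])
  have P_hol: "P holomorphic_on UNIV - {0}"
  proof -
    \<comment> \<open>The principal logarithm jumps on the negative axis. Near w0 it may be replaced by the branch
      Ln (w / w0) + Ln w0, since U does not see integer multiples of 2 pi.\<close>
    have "P field_differentiable at w0" if "w0 \<noteq> 0" for w0
    proof -
      define V where "V = (\<lambda>w. w / w0) -` (- \<real>\<^sub>\<le>\<^sub>0)"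
      have V: "open V" "w0 \<in> V" unfolding V_def using that
        by (auto intro!: open_vimage continuous_intros)
      have "(\<lambda>w. w ^ n * U (- \<i> * (Ln (w / w0) + Ln w0))) holomorphic_on V"
        by (intro holomorphic_intros holomorphic_on_compose_gen[OF _ hol, unfolded o_def])
           (auto simp: V_def that)
      moreover have "P w = w ^ n * U (- \<i> * (Ln (w / w0) + Ln w0))" if "w \<in> V" for w
      proof -
        have "w \<noteq> 0" using that \<open>w0 \<noteq> 0\<close> by (auto simp: V_def)
        then show ?thesis unfolding P_def using \<open>w0 \<noteq> 0\<close>
          by (intro arg_cong2[where f = times] per_exp refl) (simp add: exp_add)
      qed
      ultimately have "P holomorphic_on V" by (metis (no_types, lifting) holomorphic_transform)
      then show ?thesis using V holomorphic_on_imp_differentiable_at by blast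
    qed
    then show ?thesis by (auto simp: holomorphic_on_def field_differentiable_at_within)
  qed
  have P_bound: "norm (P w) \<le> C * max 1 (norm w ^ (2 * n))" if "w \<noteq> 0" for w
  proof -
    have w: "w = exp (\<i> * (- \<i> * Ln w))" using that by simp
    have nw: "norm w = exp (ln (norm w))" using that by simp
    have "norm (P w) \<le> norm w ^ n * (C * exp (real n * \<bar>ln (norm w)\<bar>))"
      using growth[of "- \<i> * Ln w"] that unfolding P_def
      by (auto simp: norm_mult norm_power intro!: mult_left_mono)
    also have "\<dots> = C * (norm w ^ n * exp (real n * \<bar>ln (norm w)\<bar>))" by simp
    also have "norm w ^ n * exp (real n * \<bar>ln (norm w)\<bar>) \<le> max 1 (norm w ^ (2 * n))"
    proof (cases "norm w \<ge> 1")
      case True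
      then have "exp (real n * \<bar>ln (norm w)\<bar>) = norm w ^ n"
        using that by (simp add: exp_of_nat_mult)
      then show ?thesis by (simp add: power_mult power2_eq_square mult_2 power_add)
    next
      case False
      then have "exp (real n * \<bar>ln (norm w)\<bar>) = inverse (norm w) ^ n"
        using that by (simp add: exp_of_nat_mult exp_minus power_inverse)
      then have "norm w ^ n * exp (real n * \<bar>ln (norm w)\<bar>) = 1"
        using that by (simp add: power_mult_distrib[symmetric])
      then show ?thesis by simp
    qed
    finally show ?thesis using C0 by (simp add: mult_left_mono)
  qed
  have "\<exists>B. eventually (\<lambda>w. norm (P w) \<le> B) (at 0)"
  proof (intro exI[of _ C])
    have "eventually (\<lambda>w::complex. w \<in> ball 0 1 - {0}) (at 0)"
      by (rule eventually_at_in_open) auto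
    then show "eventually (\<lambda>w. norm (P w) \<le> C) (at 0)"
    proof eventually_elim
      case (elim w)
      then have "norm w ^ (2 * n) \<le> 1" by (auto simp: power_le_one)
      then show ?case using P_bound[of w] elim by (simp add: max_def split: if_splits)
    qed
  qed
  then obtain Q where Q: "Q holomorphic_on UNIV" "\<And>w. w \<noteq> 0 \<Longrightarrow> Q w = P w"
    using holomorphic_on_extend_bounded[OF P_hol] by auto
  have Q_bound: "norm (Q w) \<le> C * norm w ^ (2 * n)" if "1 \<le> norm w" for w
    using that P_bound[of w] Q(2)[of w] one_le_power[OF that, of "2 * n"]
    by (cases "w = 0") (auto simp: max_def)
  define q where "q = (\<lambda>k. (deriv ^^ k) Q 0 / fact k)"
  have Q_sum: "Q w = (\<Sum>k\<le>2 * n. q k * w ^ k)" for w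
    unfolding q_def by (rule Liouville_polynomial[OF Q(1)]) (use Q_bound in auto)
  have "U (of_real t) = (\<Sum>k\<in>{- int n..int n}. q (nat (k + int n)) * exp (\<i> * of_int k * of_real t))" for t
  proof -
    have "U (of_real t) = exp (\<i> * of_real t) ^ n * U (of_real t) * exp (- (\<i> * of_real t)) ^ n"
      by (simp add: power_mult_distrib[symmetric] exp_minus)
    also have "\<dots> = (\<Sum>k\<le>2 * n. q k * exp (\<i> * of_real t) ^ k) * exp (- (\<i> * of_real t)) ^ n"
      by (simp add: P_exp[symmetric] Q(2)[symmetric] Q_sum)
    also have "\<dots> = (\<Sum>k\<le>2 * n. q k * exp (\<i> * of_int (int k - int n) * of_real t))"
    proof -
      have "exp (\<i> * of_real t) ^ k * exp (- (\<i> * of_real t)) ^ n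
          = exp (\<i> * of_int (int k - int n) * of_real t)" for k
        by (simp add: exp_of_nat_mult[symmetric] exp_add[symmetric] algebra_simps)
      then show ?thesis by (simp add: sum_distrib_right mult.assoc)
    qed
    also have "\<dots> = (\<Sum>k\<in>{- int n..int n}. q (nat (k + int n)) * exp (\<i> * of_int k * of_real t))"
      by (rule sum.reindex_bij_witness[of _ "\<lambda>k. nat (k + int n)" "\<lambda>k. int k - int n"]) auto
    finally show ?thesis .
  qed
  then show ?thesis unfolding trig_polys_def
    by (auto intro!: exI[of _ "\<lambda>k. q (nat (k + int n))"])
qed

section \<open>A weighted Nikolskii inequality\<close>

text \<open>
  Bernstein's inequality with the constant \<open>exp 1\<close> instead of \<open>1\<close>: it follows from the growth bound
  by Cauchy's estimate on circles of radius \<open>1 / n\<close> centred on the real axis.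
\<close>

lemma bernstein_increment:
  assumes M: "\<And>t::real. norm (trig_sum c n (of_real t)) \<le> M" and n: "n \<ge> 1"
  shows "norm (trig_sum c n (of_real s) - trig_sum c n (of_real t)) \<le> exp 1 * real n * M * \<bar>s - t\<bar>"
proof -
  have M0: "M \<ge> 0" using M[of 0] by (simp add: order_trans[OF norm_ge_zero])
  have der: "norm (deriv (trig_sum c n) z) \<le> exp 1 * real n * M" if "z \<in> \<real>" for z
  proof -
    have "norm ((deriv ^^ 1) (trig_sum c n) z) \<le> fact 1 * (M * exp 1) / (1 / real n) ^ 1"
    proof (rule Cauchy_inequality)
      fix x assume x: "norm (z - x) = 1 / real n"
      have "\<bar>Im x\<bar> \<le> 1 / real n"
        using abs_Im_le_cmod[of "z - x"] x that by (simp add: complex_is_Real_iff)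
      then have "exp (real n * \<bar>Im x\<bar>) \<le> exp 1"
        using n by (simp add: field_simps)
      then show "norm (trig_sum c n x) \<le> M * exp 1"
        using trig_sum_growth[OF M, of x] M0 by (meson mult_left_mono order_trans)
    qed (use n in \<open>auto intro: trig_sum_holomorphic holomorphic_on_imp_continuous_on\<close>)
    then show ?thesis by (simp add: mult_ac)
  qed
  have "norm (trig_sum c n (of_real s) - trig_sum c n (of_real t)) \<le> exp 1 * real n * M * norm (of_real s - of_real t :: complex)"
  proof (rule field_differentiable_bound[where S = \<real>])
    show "convex (\<real> :: complex set)"
      by (auto simp: convex_def complex_is_Real_iff)
    show "(trig_sum c n has_field_derivative deriv (trig_sum c n) z) (at z within \<real>)" for z
      by (rule has_field_derivative_at_within) (metis UNIV_I holomorphic_derivI open_UNIV trig_sum_holomorphic)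
  qed (use der in auto)
  then show ?thesis by (simp flip: of_real_diff)
qed

lemma sin_ge_linear:
  assumes "0 \<le> x" "x \<le> pi / 2"
  shows "2 / pi * x \<le> sin (x::real)"
proof -
  have "concave_on {0..pi} sin"
  proof (rule f''_le0_imp_concave[where f' = cos and f'' = "\<lambda>x. - sin x"])
    show "(sin has_real_derivative cos x) (at x)" "(cos has_real_derivative - sin x) (at x)" for x :: real
      by (auto intro!: derivative_eq_intros)
  qed (auto simp: sin_ge_zero)
  then have "convex_on {0..pi} (\<lambda>x. - sin x)" by (simp add: concave_on_def)
  from convex_onD[OF this, of "2 / pi * x" 0 "pi / 2"] assms show ?thesis
    by (simp add: field_simps)
qed

text \<open>
  The zeros \<open>0\<close> and \<open>\<plusminus> pi\<close> of the weight are far apart, so at most one of the two factors is small.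
  At distance of order \<open>d\<close> from the zeros this factor is at least of order \<open>d powr (2 * a)\<close> or
  \<open>d powr (2 * b)\<close>, and the former is the smaller one because of \<open>b \<le> a\<close>.
\<close>

lemma jacobi_weight_lower_bound:
  assumes ab: "0 \<le> b" "b \<le> a" and d: "0 < d" "d \<le> 1"
    and t: "d / 2 \<le> \<bar>t\<bar>" "\<bar>t\<bar> \<le> pi - d / 2"
  shows "(1 / 2) powr (2 * b) * (d / (2 * pi)) powr (2 * a) \<le> jacobi_weight a b t"
proof -
  define u where "u = \<bar>t\<bar>"
  have u: "d / 2 \<le> u" "u \<le> pi - d / 2" "0 < u" "u < pi" using t d unfolding u_def by auto
  have S: "\<bar>2 * sin (t / 2)\<bar> = 2 * sin (u / 2)"
  proof -
    have "sin (u / 2) \<ge> 0" using u by (intro sin_ge_zero) auto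
    moreover have "\<bar>sin (t / 2)\<bar> = \<bar>sin (u / 2)\<bar>" by (auto simp: u_def abs_if)
    ultimately show ?thesis by (simp add: abs_mult)
  qed
  have C: "\<bar>cos (t / 2)\<bar> = sin ((pi - u) / 2)"
  proof -
    have "cos (t / 2) = cos (u / 2)" by (auto simp: u_def abs_if)
    also have "\<dots> = sin ((pi - u) / 2)" by (simp add: cos_sin_eq diff_divide_distrib)
    finally show ?thesis using u by (simp add: sin_ge_zero)
  qed
  have s1: "2 / pi * (u / 2) \<le> sin (u / 2)" using u by (intro sin_ge_linear) auto
  have s2: "2 / pi * ((pi - u) / 2) \<le> sin ((pi - u) / 2)" using u by (intro sin_ge_linear) auto
  have dpi: "d / (2 * pi) \<le> 1 / 2" "0 < d / (2 * pi)" using d pi_gt3 by (auto simp: field_simps)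
  show ?thesis
  proof (cases "u \<le> pi / 2")
    case True
    have "d / (2 * pi) \<le> 2 * sin (u / 2)"
    proof -
      have "d / (2 * pi) \<le> 2 * (2 / pi * (u / 2))" using u by (simp add: field_simps)
      then show ?thesis using s1 by linarith
    qed
    then have 1: "(d / (2 * pi)) powr (2 * a) \<le> (2 * sin (u / 2)) powr (2 * a)"
      using ab dpi by (intro powr_mono2) auto
    have "1 / 2 \<le> sin ((pi - u) / 2)"
    proof -
      have "1 / 2 \<le> 2 / pi * ((pi - u) / 2)" using True by (simp add: field_simps)
      then show ?thesis using s2 by linarith
    qed
    then have 2: "(1 / 2) powr (2 * b) \<le> sin ((pi - u) / 2) powr (2 * b)"
      using ab by (intro powr_mono2) auto
    show ?thesis unfolding jacobi_weight_def S C using mult_mono[OF 1 2] by (simp add: mult.commute)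
  next
    case False
    have "1 \<le> 2 * sin (u / 2)"
    proof -
      have "1 / 2 \<le> 2 / pi * (u / 2)" using False by (simp add: field_simps)
      then show ?thesis using s1 by linarith
    qed
    then have 1: "(1 / 2) powr (2 * b) \<le> (2 * sin (u / 2)) powr (2 * a)"
      using ab powr_le1[of "2 * b" "1 / 2"] ge_one_powr_ge_zero[of "2 * sin (u / 2)" "2 * a"] by simp
    have "d / (2 * pi) \<le> sin ((pi - u) / 2)"
    proof -
      have "d / (2 * pi) \<le> 2 / pi * ((pi - u) / 2)" using u by (simp add: field_simps)
      then show ?thesis using s2 by linarith
    qed
    then have "(d / (2 * pi)) powr (2 * b) \<le> sin ((pi - u) / 2) powr (2 * b)"
      using ab dpi by (intro powr_mono2) auto
    moreover have "(d / (2 * pi)) powr (2 * a) \<le> (d / (2 * pi)) powr (2 * b)"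
      using ab dpi by (intro powr_mono') linarith+
    ultimately have 2: "(d / (2 * pi)) powr (2 * a) \<le> sin ((pi - u) / 2) powr (2 * b)" by linarith
    show ?thesis unfolding jacobi_weight_def S C using mult_mono[OF 1 2] by simp
  qed
qed

lemma jacobi_weight_nonneg: "0 \<le> jacobi_weight a b t"
  unfolding jacobi_weight_def by simp

lemma jacobi_weight_le: 
  assumes "0 \<le> a" "0 \<le> b"
  shows "jacobi_weight a b t \<le> \<bar>t\<bar> powr (2 * a)"
proof -
  have "\<bar>2 * sin (t / 2)\<bar> \<le> \<bar>t\<bar>"
    using abs_sin_x_le_abs_x[of "t / 2"] by (simp add: abs_mult)
  then have "\<bar>2 * sin (t / 2)\<bar> powr (2 * a) \<le> \<bar>t\<bar> powr (2 * a)"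
    using assms by (intro powr_mono2) auto
  moreover have "\<bar>cos (t / 2)\<bar> powr (2 * b) \<le> 1"
    using assms by (intro powr_le1) auto
  ultimately show ?thesis unfolding jacobi_weight_def
    using mult_mono[of "\<bar>2 * sin (t / 2)\<bar> powr (2 * a)" "\<bar>t\<bar> powr (2 * a)" "\<bar>cos (t / 2)\<bar> powr (2 * b)" 1] by simp
qed

lemma jacobi_weight_measurable [measurable]: "jacobi_weight a b \<in> borel_measurable borel"
  unfolding jacobi_weight_def by measurable

text \<open>
  A short interval near any given point of \<open>[- pi, pi]\<close> that avoids the zeros of the weight. It is
  found by moving the point into \<open>[d, pi - d]\<close> or its mirror image.
\<close>

lemma point_away_from_zeros:
  assumes t: "\<bar>t0\<bar> \<le> pi" and d: "0 < d" "d \<le> 1"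
  obtains s :: real where "\<bar>s - t0\<bar> \<le> d"
    "\<And>t. \<bar>t - s\<bar> \<le> d / 2 \<Longrightarrow> d / 2 \<le> \<bar>t\<bar> \<and> \<bar>t\<bar> \<le> pi - d / 2"
proof (cases "t0 \<ge> 0")
  case True
  show ?thesis
    by (rule that[of "max d (min (pi - d) t0)"])
       (use True t d pi_gt3 in \<open>auto simp: max_def min_def abs_if split: if_splits\<close>)
next
  case False
  show ?thesis
    by (rule that[of "- max d (min (pi - d) (- t0))"])
       (use False t d pi_gt3 in \<open>auto simp: max_def min_def abs_if split: if_splits\<close>)
qed

lemma integrable_indicator_Icc: "integrable lebesgue (indicat_real {l..u::real})"
  using fmeasurableD2[OF lmeasurable_interval(1)[of l u]]
  by (intro integrable_real_indicator) (auto simp: less_top)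

lemma set_integrable_Icc_bounded:
  fixes g :: "real \<Rightarrow> real"
  assumes "g \<in> borel_measurable lebesgue" and le: "\<And>t. t \<in> {l..u} \<Longrightarrow> \<bar>g t\<bar> \<le> B"
  shows "set_integrable lebesgue {l..u} g"
  unfolding set_integrable_def
proof (rule Bochner_Integration.integrable_bound)
  show "integrable lebesgue (\<lambda>t. indicat_real {l..u} t * B)"
    by (intro integrable_mult_left integrable_indicator_Icc)
  show "(\<lambda>t. indicat_real {l..u} t *\<^sub>R g t) \<in> borel_measurable lebesgue"
    by (intro borel_measurable_scaleR borel_measurable_indicator assms(1)) auto
qed (auto intro!: AE_I2 simp: indicator_def order_trans[OF le abs_ge_self])

lemma trig_sum_attains_max:
  obtains t0 :: real where "\<bar>t0\<bar> \<le> pi" "\<And>t::real. norm (trig_sum c n (of_real t)) \<le> norm (trig_sum c n (of_real t0))"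
proof -
  have "continuous_on {- pi..pi} (\<lambda>t. norm (trig_sum c n (of_real t)))"
    unfolding trig_sum_def by (intro continuous_intros)
  then obtain t0 where t0: "t0 \<in> {- pi..pi}"
    "\<And>t. t \<in> {- pi..pi} \<Longrightarrow> norm (trig_sum c n (of_real t)) \<le> norm (trig_sum c n (of_real t0))"
    using continuous_attains_sup[of "{- pi..pi}" "\<lambda>t. norm (trig_sum c n (of_real t))"] by auto
  show ?thesis
  proof (rule that)
    show "\<bar>t0\<bar> \<le> pi" using t0(1) by auto
    fix t :: real
    define t' where "t' = Arg (exp (\<i> * of_real t))"
    have "exp (\<i> * of_real t') = exp (\<i> * of_real t)"
      unfolding t'_def by (subst complex_norm_eq_1_exp_eq[symmetric]) (simp add: norm_exp_eq_Re)
    then have "trig_sum c n (of_real t) = trig_sum c n (of_real t')"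
      by (intro periodic_eq_of_exp_eq[of "trig_sum c n", OF trig_sum_periodic]) simp
    moreover have "t' \<in> {- pi..pi}" unfolding t'_def using Arg_bounded[of "exp (\<i> * of_real t)"] by auto
    ultimately show "norm (trig_sum c n (of_real t)) \<le> norm (trig_sum c n (of_real t0))"
      using t0(2) by simp
  qed
qed

lemma trig_sum_measurable [measurable]: "(\<lambda>t. trig_sum c n (of_real t)) \<in> borel_measurable borel"
  unfolding trig_sum_def by (intro borel_measurable_continuous_onI continuous_intros)

text \<open>
  If \<open>\<bar>T\<bar>\<close> has its maximum \<open>M\<close> at \<open>t0\<close>, then by Bernstein's inequality \<open>\<bar>T\<bar> \<ge> M / 2\<close> at distances
  of order \<open>1 / n\<close> from \<open>t0\<close>. An interval of that size and distance on which the weight is at least of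
  order \<open>n powr (- 2 * a)\<close> contributes at least a multiple of \<open>M powr p * n powr (- 2 * a - 1)\<close>.
\<close>

lemma weighted_nikolskii:
  assumes ab: "0 \<le> b" "b \<le> a" and p: "0 < p"
  obtains K where "0 < K" "\<And>n c s. n \<ge> 1 \<Longrightarrow> norm (trig_sum c n (of_real s)) powr p \<le> K * real n powr (2 * a + 1) *
    (LINT t:{-pi..pi}|lebesgue. norm (trig_sum c n (of_real t)) powr p * jacobi_weight a b t)"
proof (rule that)
  define K where "K = 2 powr p * 2 powr (2 * b) * (2 * pi) powr (2 * a) * 10 powr (2 * a + 1)"
  show "0 < K" unfolding K_def by simp
  fix n c and s :: real assume n: "n \<ge> (1::nat)"
  let ?T = "\<lambda>t::real. trig_sum c n (of_real t)"
  obtain t0 where t0: "\<bar>t0\<bar> \<le> pi" "\<And>t. norm (?T t) \<le> norm (?T t0)"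
    by (rule trig_sum_attains_max) blast
  define M where "M = norm (?T t0)"
  have M0: "0 \<le> M" by (simp add: M_def)
  \<comment> \<open>All points in question are within 3 d / 2 of t0, where T varies by at most
    exp 1 * n * M * 3 d / 2 \<le> M / 2.\<close>
  define d where "d = 1 / (10 * real n)"
  have d: "0 < d" "d \<le> 1" using n unfolding d_def by (auto simp: field_simps)
  obtain s' where s': "\<bar>s' - t0\<bar> \<le> d"
    "\<And>t. \<bar>t - s'\<bar> \<le> d / 2 \<Longrightarrow> d / 2 \<le> \<bar>t\<bar> \<and> \<bar>t\<bar> \<le> pi - d / 2"
    using point_away_from_zeros[OF t0(1) d] by blast
  define V where "V = (M / 2) powr p * ((1 / 2) powr (2 * b) * (d / (2 * pi)) powr (2 * a))"
  have V: "V \<le> norm (?T t) powr p * jacobi_weight a b t" if t: "\<bar>t - s'\<bar> \<le> d / 2" for t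
  proof -
    have "norm (?T t0 - ?T t) \<le> exp 1 * real n * M * \<bar>t0 - t\<bar>"
      using t0(2) n unfolding M_def by (intro bernstein_increment) auto
    also have "\<dots> \<le> 3 * real n * M * (3 / 2 * d)"
      using s'(1) t M0 exp_le by (intro mult_mono mult_nonneg_nonneg) (auto simp: abs_if split: if_splits)
    also have "\<dots> \<le> M / 2" using n M0 unfolding d_def by (simp add: field_simps)
    finally have "M / 2 \<le> norm (?T t)"
      using norm_triangle_ineq2[of "?T t0" "?T t"] unfolding M_def by linarith
    then have "(M / 2) powr p \<le> norm (?T t) powr p" using M0 p by (intro powr_mono2) auto
    then show ?thesis unfolding V_def
      using jacobi_weight_lower_bound[OF ab d] s'(2)[OF t] by (intro mult_mono) auto
  qed
  have "measure lebesgue {s' - d / 2..s' + d / 2} * V = (LINT t|lebesgue. indicat_real {s' - d / 2..s' + d / 2} t * V)"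
    by simp
  also have "\<dots> \<le> (LINT t:{-pi..pi}|lebesgue. norm (?T t) powr p * jacobi_weight a b t)"
    unfolding set_lebesgue_integral_def
  proof (rule integral_mono)
    show "integrable lebesgue (\<lambda>t. indicat_real {s' - d / 2..s' + d / 2} t * V)"
      by (intro integrable_mult_left integrable_indicator_Icc)
    have "set_integrable lebesgue {-pi..pi} (\<lambda>t. norm (?T t) powr p * jacobi_weight a b t)"
    proof (rule set_integrable_Icc_bounded)
      show "(\<lambda>t. norm (?T t) powr p * jacobi_weight a b t) \<in> borel_measurable lebesgue"
        by (rule measurable_completion) measurable
      fix t assume "t \<in> {-pi..pi}"
      then have "jacobi_weight a b t \<le> pi powr (2 * a)"
        using jacobi_weight_le[of a b t] powr_mono2[of "2 * a" "\<bar>t\<bar>" pi] ab by (auto simp: abs_if split: if_splits)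
      moreover have "norm (?T t) powr p \<le> M powr p" using t0(2) p unfolding M_def by (intro powr_mono2) auto
      ultimately show "\<bar>norm (?T t) powr p * jacobi_weight a b t\<bar> \<le> M powr p * pi powr (2 * a)"
        using jacobi_weight_nonneg[of a b t] by (auto simp: abs_mult intro!: mult_mono)
    qed
    then show "integrable lebesgue (\<lambda>t. indicat_real {-pi..pi} t *\<^sub>R (norm (?T t) powr p * jacobi_weight a b t))"
      by (simp add: set_integrable_def)
    fix t
    show "indicat_real {s' - d / 2..s' + d / 2} t * V \<le> indicat_real {-pi..pi} t *\<^sub>R (norm (?T t) powr p * jacobi_weight a b t)"
    proof (cases "t \<in> {s' - d / 2..s' + d / 2}")
      case True
      then have "s' - d / 2 \<le> t" "t \<le> s' + d / 2" by auto
      then have t: "\<bar>t - s'\<bar> \<le> d / 2" by linarith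
      then have "t \<in> {-pi..pi}" using s'(2)[OF t] d by auto
      then show ?thesis using V[OF t] True by simp
    qed (simp add: jacobi_weight_nonneg)
  qed
  finally have I: "d * V \<le> (LINT t:{-pi..pi}|lebesgue. norm (?T t) powr p * jacobi_weight a b t)"
    using d by simp
  have powr_20: "20 powr (2 * a) = 2 powr (2 * a) * 10 powr (2 * a)"
    using powr_mult[of 2 10 "2 * a"] by simp
  have "norm (?T s) powr p \<le> M powr p" using t0(2) p unfolding M_def by (intro powr_mono2) auto
  also have "M powr p = K * real n powr (2 * a + 1) * (d * V)"
    unfolding K_def V_def d_def using n M0
    by (simp add: powr_divide powr_mult powr_add powr_20)
  also have "\<dots> \<le> K * real n powr (2 * a + 1) * (LINT t:{-pi..pi}|lebesgue. norm (?T t) powr p * jacobi_weight a b t)"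
    using I \<open>0 < K\<close> by (intro mult_left_mono) auto
  finally show "norm (?T s) powr p \<le> K * real n powr (2 * a + 1) *
    (LINT t:{-pi..pi}|lebesgue. norm (?T t) powr p * jacobi_weight a b t)" .
qed

section \<open>Growth of functions of exponential type in a weighted Lebesgue class\<close>

text \<open>
  The maximum principle applies on bounded pieces of the quadrant after multiplication with a damping
  factor that beats \<open>exp (\<tau> * \<bar>z\<bar>)\<close> without exceeding \<open>1\<close>: \<open>exp (- \<delta> * w powr (3 / 2))\<close>, where
  \<open>w = 1 + (1 - \<i>) * z\<close> ranges over the sector \<open>\<bar>Im w\<bar> \<le> Re w\<close>, so that the real part of
  \<open>w powr (3 / 2)\<close> is comparable with \<open>\<bar>w\<bar> powr (3 / 2)\<close>. Then \<open>\<delta>\<close> tends to \<open>0\<close>.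
\<close>

lemma phragmen_lindelof_quadrant:
  fixes g :: "complex \<Rightarrow> complex"
  assumes hol: "g holomorphic_on UNIV" and \<tau>: "0 \<le> \<tau>"
    and growth: "\<And>z. norm (g z) \<le> A * exp (\<tau> * norm z)"
    and re: "\<And>x. 0 \<le> x \<Longrightarrow> norm (g (of_real x)) \<le> M"
    and im: "\<And>y. 0 \<le> y \<Longrightarrow> norm (g (\<i> * of_real y)) \<le> M"
    and z: "0 \<le> Re z" "0 \<le> Im z"
  shows "norm (g z) \<le> M"
proof -
  define Q where "Q = {z. 0 \<le> Re z \<and> 0 \<le> Im z}"
  \<comment> \<open>The power w powr (3 / 2) is written as v ^ 3 with v the square root of w; for
    v = r + \<i> s the sector condition becomes \<bar>s\<bar> \<le> r / 2, whence Re (v ^ 3) = r ^ 3 - 3 r s ^ 2 \<ge> r ^ 3 / 4.\<close>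
  define v where "v = (\<lambda>z. csqrt (1 + (1 - \<i>) * z))"
  have Re_w: "Re (1 + (1 - \<i>) * z) = 1 + Re z + Im z" and Im_w: "Im (1 + (1 - \<i>) * z) = Im z - Re z" for z
    by simp_all
  have v2: "(v z)\<^sup>2 = 1 + (1 - \<i>) * z" for z unfolding v_def by simp
  have v_Re: "0 \<le> Re (v z)" for z
    unfolding v_def using csqrt_principal[of "1 + (1 - \<i>) * z"] by linarith
  have v_Re_sq: "norm z \<le> (Re (v z))\<^sup>2" and v3: "(Re (v z)) ^ 3 / 4 \<le> Re (v z ^ 3)" if "z \<in> Q" for z
  proof -
    define r s where "r = Re (v z)" and "s = Im (v z)"
    have v: "v z = Complex r s" by (simp add: r_def s_def)
    have rs: "r\<^sup>2 - s\<^sup>2 = 1 + Re z + Im z" "2 * r * s = Im z - Re z"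
      using arg_cong[OF v2[of z], of Re] arg_cong[OF v2[of z], of Im] unfolding v
      by (simp_all add: power2_eq_square Re_w Im_w)
    have r0: "0 \<le> r" unfolding r_def by (rule v_Re)
    have z': "0 \<le> Re z" "0 \<le> Im z" using that by (auto simp: Q_def)
    have "norm z \<le> Re z + Im z" using cmod_le[of z] z' by simp
    then show "norm z \<le> (Re (v z))\<^sup>2" using rs(1) z' zero_le_power2[of s] unfolding r_def[symmetric] by linarith
    have "2 * r * \<bar>s\<bar> \<le> r\<^sup>2 - s\<^sup>2"
    proof -
      have "2 * r * \<bar>s\<bar> = \<bar>2 * r * s\<bar>" using r0 by (simp add: abs_mult)
      then show ?thesis using rs z' by linarith
    qed
    have s_le: "\<bar>s\<bar> \<le> r / 2"
    proof (rule ccontr)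
      assume "\<not> \<bar>s\<bar> \<le> r / 2"
      then have "r \<le> 2 * \<bar>s\<bar>" "0 < s\<^sup>2" using r0 by auto
      then have "r * r \<le> r * (2 * \<bar>s\<bar>)" using r0 by (intro mult_left_mono)
      then show False using \<open>2 * r * \<bar>s\<bar> \<le> r\<^sup>2 - s\<^sup>2\<close> \<open>0 < s\<^sup>2\<close> by (simp add: power2_eq_square)
    qed
    have "s\<^sup>2 \<le> (r / 2)\<^sup>2" using s_le r0 by (intro abs_le_square_iff[THEN iffD1]) auto
    then have "s\<^sup>2 \<le> r\<^sup>2 / 4" by (simp add: power_divide)
    then have "3 * r * s\<^sup>2 \<le> 3 * r * (r\<^sup>2 / 4)" using r0 by (intro mult_left_mono) auto
    then show "(Re (v z)) ^ 3 / 4 \<le> Re (v z ^ 3)"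
      by (simp add: v power3_eq_cube power2_eq_square algebra_simps)
  qed
  have M0: "0 \<le> M" using re[of 0] by (simp add: order_trans[OF norm_ge_zero])
  have zQ: "z \<in> Q" using z by (simp add: Q_def)
  have damped: "norm (g z) * exp (- (\<delta> * Re (v z ^ 3))) \<le> M'" if \<delta>: "\<delta> > 0" and M': "M < M'" for \<delta> M'
  proof -
    define h where "h = (\<lambda>z. g z * exp (- (of_real \<delta> * v z ^ 3)))"
    have h_norm: "norm (h z) = norm (g z) * exp (- (\<delta> * Re (v z ^ 3)))" for z
      by (simp add: h_def norm_mult norm_exp_eq_Re)
    have h_le: "norm (h z) \<le> norm (g z)" if "z \<in> Q" for z
    proof -
      have "0 \<le> Re (v z ^ 3)" using v3[OF that] zero_le_power[OF v_Re[of z], of 3] by linarith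
      then have "exp (- (\<delta> * Re (v z ^ 3))) \<le> 1" using \<delta> by simp
      then show ?thesis unfolding h_norm by (simp add: mult_left_le)
    qed
    have M'0: "0 < M'" using M0 M' by simp
    \<comment> \<open>On the arc \<bar>z\<bar> = q ^ 2 the real part of v is at least q. The second lower bound for q makes the
      damping win over the growth with exp (- q) to spare, and the third absorbs the constant A.\<close>
    define q where "q = max (norm z + 1) (max (4 * (\<tau> + 1) / \<delta>) (\<bar>A\<bar> / M'))"
    have q: "1 \<le> q" "norm z \<le> q" "4 * (\<tau> + 1) / \<delta> \<le> q" "\<bar>A\<bar> / M' \<le> q"
      unfolding q_def by (auto simp: le_max_iff_disj)
    define S where "S = Q \<inter> cball 0 (q\<^sup>2)"
    have clS: "closed S" unfolding S_def Q_def
      by (intro closed_Int closed_Collect_conj closed_cball closed_Collect_le continuous_intros)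
    have "norm z \<le> q\<^sup>2" using q power_increasing[of 1 2 q] by simp
    then have zS: "z \<in> S" using zQ by (simp add: S_def)
    define D where "D = {z. 0 < Re (1 + (1 - \<i>) * z)}"
    have h_hol: "h holomorphic_on D"
    proof -
      have "v holomorphic_on D" unfolding v_def
        by (intro holomorphic_on_compose_gen[OF _ holomorphic_on_csqrt, unfolded o_def] holomorphic_intros)
           (auto simp: D_def complex_nonpos_Reals_iff)
      then show ?thesis unfolding h_def
        by (intro holomorphic_intros) (auto intro: holomorphic_on_subset[OF hol])
    qed
    have SD: "S \<subseteq> D" by (auto simp: S_def Q_def D_def)
    have "norm (h z) \<le> M'"
    proof (rule maximum_modulus_frontier[of h S])
      show "h holomorphic_on interior S"
        using h_hol SD interior_subset by (meson holomorphic_on_subset order_trans)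
      show "continuous_on (closure S) h"
        using h_hol SD clS by (metis closure_closed continuous_on_subset holomorphic_on_imp_continuous_on)
      show "bounded S" unfolding S_def by (simp add: bounded_Int)
      show "z \<in> S" by (rule zS)
      fix y assume "y \<in> frontier S"
      then have yS: "y \<in> S" and yI: "y \<notin> interior S" using clS by (auto simp: frontier_def)
      have yQ: "y \<in> Q" using yS by (simp add: S_def)
      have "\<not> (0 < Re y \<and> 0 < Im y \<and> norm y < q\<^sup>2)"
      proof
        assume *: "0 < Re y \<and> 0 < Im y \<and> norm y < q\<^sup>2"
        have "open {z. 0 < Re z}" "open {z. 0 < Im z}"
          by (rule open_halfspace_Re_gt, rule open_halfspace_Im_gt)
        then have 1: "open ({z. 0 < Re z} \<inter> {z. 0 < Im z} \<inter> ball 0 (q\<^sup>2))" (is "open ?U")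
          by (intro open_Int open_ball)
        have 2: "?U \<subseteq> S" by (auto simp: S_def Q_def)
        have 3: "y \<in> ?U" using * by simp
        show False using interiorI[OF 1 3 2] yI by blast
      qed
      then consider "Re y = 0" | "Im y = 0" | "norm y = q\<^sup>2"
        using yS by (fastforce simp: S_def Q_def)
      then show "norm (h y) \<le> M'"
      proof cases
        case 1
        then have "y = \<i> * of_real (Im y)" by (simp add: complex_eq_iff)
        then have "norm (g y) \<le> M" using im[of "Im y"] yQ by (auto simp: Q_def)
        then show ?thesis using h_le[OF yQ] M' by linarith
      next
        case 2
        then have "y = of_real (Re y)" by (simp add: complex_eq_iff)
        then have "norm (g y) \<le> M" using re[of "Re y"] yQ by (auto simp: Q_def)
        then show ?thesis using h_le[OF yQ] M' by linarith
      next
        case 3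
        define r where "r = Re (v y)"
        have "q\<^sup>2 \<le> r\<^sup>2" using v_Re_sq[OF yQ] 3 unfolding r_def by linarith
        then have "q \<le> r" by (rule power2_le_imp_le) (simp add: r_def v_Re)
        then have "q ^ 3 \<le> r ^ 3" using q by (intro power_mono) auto
        then have "q ^ 3 / 4 \<le> Re (v y ^ 3)" using v3[OF yQ] unfolding r_def by linarith
        then have "\<delta> * (q ^ 3 / 4) \<le> \<delta> * Re (v y ^ 3)" using \<delta> by (intro mult_left_mono) auto
        moreover have "(\<tau> + 1) * q\<^sup>2 \<le> \<delta> * (q ^ 3 / 4)"
        proof -
          have "4 * (\<tau> + 1) \<le> q * \<delta>" using q(3) \<delta> by (simp add: pos_divide_le_eq)
          then have "4 * (\<tau> + 1) * q\<^sup>2 \<le> (q * \<delta>) * q\<^sup>2" by (intro mult_right_mono) auto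
          then show ?thesis by (simp add: power3_eq_cube power2_eq_square algebra_simps)
        qed
        ultimately have e: "\<tau> * q\<^sup>2 + - (\<delta> * Re (v y ^ 3)) \<le> - q" 
          using q(1) power_increasing[of 1 2 q] by (simp add: algebra_simps)
        have "norm (h y) \<le> (\<bar>A\<bar> * exp (\<tau> * q\<^sup>2)) * exp (- (\<delta> * Re (v y ^ 3)))"
          unfolding h_norm using growth[of y] 3
          by (intro mult_right_mono) (auto intro: order_trans[OF _ mult_right_mono[OF abs_ge_self]])
        also have "\<dots> = \<bar>A\<bar> * exp (\<tau> * q\<^sup>2 + - (\<delta> * Re (v y ^ 3)))" by (simp only: exp_add mult.assoc)
        also have "\<dots> \<le> \<bar>A\<bar> * exp (- q)" using e by (intro mult_left_mono) auto
        also have "\<dots> \<le> (M' * q) * exp (- q)" using q(4) M'0 by (intro mult_right_mono) (auto simp: pos_divide_le_eq mult.commute)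
        also have "\<dots> = M' * (q * exp (- q))" by simp
        also have "q * exp (- q) \<le> 1"
        proof -
          have "q \<le> exp q" using exp_ge_add_one_self[of q] by linarith
          then show ?thesis by (simp add: exp_minus divide_simps)
        qed
        finally show ?thesis using M'0 by (simp add: mult_left_mono)
      qed
    qed
    then show ?thesis by (simp add: h_norm)
  qed
  have "norm (g z) \<le> M'" if M': "M < M'" for M'
  proof -
    have "((\<lambda>\<delta>. norm (g z) * exp (- (\<delta> * Re (v z ^ 3)))) \<longlongrightarrow> norm (g z) * exp (- (0 * Re (v z ^ 3)))) (at_right 0)"
      by (intro tendsto_intros)
    moreover have "eventually (\<lambda>\<delta>. norm (g z) * exp (- (\<delta> * Re (v z ^ 3))) \<le> M') (at_right 0)"
      using eventually_at_right_less by eventually_elim (rule damped[OF _ M'])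
    ultimately have "norm (g z) * exp (- (0 * Re (v z ^ 3))) \<le> M'"
      by (rule tendsto_upperbound) simp
    then show ?thesis by simp
  qed
  then show ?thesis by (rule dense_ge)
qed

text \<open>
  Phragmen--Lindelof in each of the four quadrants, rotated onto the first one by \<open>u\<close>, for \<open>F\<close> times
  the exponential (with exponent a multiple \<open>\<kappa>\<close> of the rotated variable) that equals
  \<open>exp (- \<tau> * \<bar>Im z\<bar>)\<close> in modulus on the quadrant.
\<close>

lemma bounded_on_reals_imp_growth:
  fixes F :: "complex \<Rightarrow> complex"
  assumes hol: "F holomorphic_on UNIV" and \<tau>: "0 \<le> \<tau>"
    and growth: "\<And>z. norm (F z) \<le> C * exp (\<tau> * norm z)"
    and real: "\<And>x. norm (F (of_real x)) \<le> B"
  shows "norm (F z) \<le> max B C * exp (\<tau> * \<bar>Im z\<bar>)"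
proof -
  have C0: "0 \<le> C" using growth[of 0] by (simp add: order_trans[OF norm_ge_zero])
  have main: "norm (F (u * y)) * exp (- (\<tau> * Re (\<kappa> * y))) \<le> max B C"
    if u: "norm u = 1" and \<kappa>: "norm \<kappa> = 1"
      and axes: "u \<in> \<real> \<and> \<kappa> = - \<i> \<or> \<i> * u \<in> \<real> \<and> \<kappa> = 1"
      and y: "0 \<le> Re y" "0 \<le> Im y" for u \<kappa> y
  proof -
    define g where "g = (\<lambda>y. F (u * y) * exp (- (of_real \<tau> * (\<kappa> * y))))"
    have g_norm: "norm (g y) = norm (F (u * y)) * exp (- (\<tau> * Re (\<kappa> * y)))" for y
      by (simp add: g_def norm_mult norm_exp_eq_Re)
    have gF: "norm (F (u * y)) \<le> C * exp (\<tau> * norm y)" for y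
      using growth[of "u * y"] u by (simp add: norm_mult)
    have on_real: "norm (F w) \<le> B" if "w \<in> \<real>" for w using real that by (auto elim: Reals_cases)
    have "norm (g y) \<le> max B C"
    proof (rule phragmen_lindelof_quadrant[where g = g and \<tau> = "2 * \<tau>" and A = C])
      have "(\<lambda>y. F (u * y)) holomorphic_on UNIV"
        using holomorphic_on_compose_gen[of "(*) u" UNIV F UNIV] hol
        by (simp add: o_def holomorphic_intros)
      then show "g holomorphic_on UNIV" unfolding g_def by (intro holomorphic_intros)
      show "norm (g y) \<le> C * exp (2 * \<tau> * norm y)" for y
      proof -
        have "norm (\<kappa> * y) = norm y" using \<kappa> by (simp add: norm_mult)
        then have "- Re (\<kappa> * y) \<le> norm y" using abs_Re_le_cmod[of "\<kappa> * y"] by linarith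
        then have "- (\<tau> * Re (\<kappa> * y)) \<le> \<tau> * norm y" using \<tau> by (metis mult_left_mono mult_minus_right)
        then have "exp (- (\<tau> * Re (\<kappa> * y))) \<le> exp (\<tau> * norm y)" by simp
        then have "norm (g y) \<le> (C * exp (\<tau> * norm y)) * exp (\<tau> * norm y)"
          unfolding g_norm using gF C0 by (intro mult_mono) auto
        then show ?thesis by (simp add: exp_add[symmetric] algebra_simps)
      qed
      have imag_axis: "norm (F (u * y)) * exp (- (\<tau> * norm y)) \<le> C" for y
        using gF[of y] by (simp add: exp_minus field_simps)
      show "norm (g (of_real x)) \<le> max B C" if "0 \<le> x" for x
        using axes
      proof
        assume "u \<in> \<real> \<and> \<kappa> = - \<i>"
        then show ?thesis using on_real[of "u * of_real x"] by (simp add: g_norm)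
      next
        assume "\<i> * u \<in> \<real> \<and> \<kappa> = 1"
        then show ?thesis using imag_axis[of "of_real x"] that by (simp add: g_norm)
      qed
      show "norm (g (\<i> * of_real x)) \<le> max B C" if "0 \<le> x" for x
        using axes
      proof
        assume "u \<in> \<real> \<and> \<kappa> = - \<i>"
        then show ?thesis using imag_axis[of "\<i> * of_real x"] that by (simp add: g_norm norm_mult)
      next
        assume *: "\<i> * u \<in> \<real> \<and> \<kappa> = 1"
        then have "(\<i> * u) * of_real x \<in> \<real>" by (intro Reals_mult[OF _ Reals_of_real]) blast
        then have "u * (\<i> * of_real x) \<in> \<real>" by (simp add: mult_ac)
        then show ?thesis using on_real[of "u * (\<i> * of_real x)"] * by (simp add: g_norm)
      qed
    qed (use \<tau> y in auto)
    then show ?thesis by (simp add: g_norm)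
  qed
  have unpack: "norm (F z) \<le> max B C * exp t" if "norm (F z) * exp (- t) \<le> max B C" for t
    using that by (simp add: exp_minus field_simps)
  consider "0 \<le> Re z" "0 \<le> Im z" | "Re z \<le> 0" "0 \<le> Im z" | "Re z \<le> 0" "Im z \<le> 0" | "0 \<le> Re z" "Im z \<le> 0"
    by linarith
  then show ?thesis
  proof cases
    case 1
    then show ?thesis using main[of 1 "- \<i>" z] by (intro unpack) simp
  next
    case 2
    then show ?thesis using main[of \<i> 1 "- \<i> * z"] by (intro unpack) simp
  next
    case 3
    then show ?thesis using main[of "- 1" "- \<i>" "- z"] by (intro unpack) simp
  next
    case 4
    then show ?thesis using main[of "- \<i>" 1 "\<i> * z"] by (intro unpack) simp
  qed
qed

lemma entire_primitive:
  fixes F :: "complex \<Rightarrow> complex"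
  assumes "F holomorphic_on UNIV"
  obtains \<Phi> where "\<And>z. (\<Phi> has_field_derivative F z) (at z)"
  using holomorphic_convex_primitive'[of UNIV F] assms by auto

text \<open>
  Away from the origin the weight is at least \<open>1\<close> and \<open>y \<le> 1 + y powr p\<close> since \<open>p \<ge> 1\<close>; near the
  origin, where the weight may vanish, continuity is enough. This is how weighted integrability
  controls local integrals of \<open>\<bar>g\<bar>\<close>.
\<close>

lemma norm_le_one_plus_weighted_power:
  assumes p: "1 \<le> p" and a: "0 \<le> a" and cont: "continuous_on UNIV g"
  obtains K :: real where "0 \<le> K" "\<And>t::real. norm (g t :: complex) \<le> K + norm (g t) powr p * power_weight a t"
proof -
  have "compact (g ` {-1..1})" by (intro compact_continuous_image continuous_on_subset[OF cont]) auto
  then obtain K0 where K0: "\<And>t. t \<in> {-1..1} \<Longrightarrow> norm (g t) \<le> K0"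
    by (meson bounded_iff compact_imp_bounded imageI)
  have "norm (g t) \<le> (1 + max 0 K0) + norm (g t) powr p * power_weight a t" for t
  proof (cases "\<bar>t\<bar> \<le> 1")
    case True
    then have "norm (g t) \<le> K0" by (intro K0) auto
    moreover have "0 \<le> norm (g t) powr p * power_weight a t" by (simp add: power_weight_def)
    ultimately show ?thesis by linarith
  next
    case False
    then have w: "1 \<le> power_weight a t" unfolding power_weight_def using a by (intro ge_one_powr_ge_zero) auto
    have "norm (g t) \<le> 1 + norm (g t) powr p"
    proof (cases "norm (g t) \<le> 1")
      case False
      then show ?thesis using powr_mono[of 1 p "norm (g t)"] p by auto
    qed (simp add: add_increasing2)
    also have "norm (g t) powr p \<le> norm (g t) powr p * power_weight a t"
      using w mult_left_mono[of 1 "power_weight a t" "norm (g t) powr p"] by simp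
    finally show ?thesis by simp
  qed
  then show ?thesis by (intro that[of "1 + max 0 K0"]) auto
qed

text \<open>
  Integrability controls only averages of \<open>F\<close>, so consider the moving integrals
  \<open>H z = \<Phi> (z + s) - \<Phi> z\<close> with a primitive \<open>\<Phi>\<close> of \<open>F\<close> and \<open>0 \<le> s \<le> 1\<close>. They are bounded on the real
  axis, hence by Phragmen--Lindelof in a strip around it, and Cauchy's estimate bounds their
  derivative \<open>F (x + s) - F x\<close>. Thus \<open>F x\<close> stays within a bounded distance of its bounded mean over
  \<open>[x, x + 1]\<close>.
\<close>

lemma exp_type_Lp_bounded_on_reals:
  assumes F: "F \<in> exp_type_Lp \<sigma> p a" and p: "1 \<le> p" and a: "0 \<le> a" and \<sigma>: "0 < \<sigma>"
  obtains B where "\<And>x. norm (F (of_real x)) \<le> B"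
proof -
  have hol: "F holomorphic_on UNIV" using F by (auto simp: exp_type_Lp_def exp_type_le_def)
  define \<tau> where "\<tau> = \<sigma> + 1"
  have \<tau>: "0 \<le> \<tau>" using \<sigma> by (simp add: \<tau>_def)
  have "\<exists>C. \<forall>z. norm (F z) \<le> C * exp ((\<sigma> + 1) * norm z)"
    using F zero_less_one unfolding exp_type_Lp_def exp_type_le_def by blast
  then obtain C where C: "\<And>z. norm (F z) \<le> C * exp (\<tau> * norm z)"
    unfolding \<tau>_def by blast
  have C0: "0 \<le> C" using C[of 0] by (simp add: order_trans[OF norm_ge_zero])
  have contF: "continuous_on UNIV (\<lambda>x. F (of_real x))"
    by (intro continuous_on_compose2[OF holomorphic_on_imp_continuous_on[OF hol]] continuous_intros) auto
  define h where "h = (\<lambda>t. norm (F (of_real t)) powr p * power_weight a t)"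
  have h_int: "integrable lebesgue h" and h0: "0 \<le> h t" for t
    using F by (auto simp: exp_type_Lp_def Lp_power_def h_def power_weight_def)
  define N where "N = integral\<^sup>L lebesgue h"
  have h_hk: "(h has_integral N) UNIV" unfolding N_def by (rule has_integral_integral_lebesgue[OF h_int])
  obtain K where K: "0 \<le> K" "\<And>t. norm (F (of_real t)) \<le> K + h t"
    unfolding h_def by (rule norm_le_one_plus_weighted_power[OF p a contF]) blast
  obtain \<Phi> where \<Phi>: "\<And>z. (\<Phi> has_field_derivative F z) (at z)" by (rule entire_primitive[OF hol]) blast
  have \<Phi>_hol: "\<Phi> holomorphic_on UNIV"
    using \<Phi> by (auto simp: holomorphic_on_def field_differentiable_def)
  have real_bound: "norm (\<Phi> (of_real x + of_real s) - \<Phi> (of_real x)) \<le> K + N" if s: "0 \<le> s" "s \<le> 1" for x s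
  proof -
    have ftc: "((\<lambda>t. F (of_real t)) has_integral (\<Phi> (of_real (x + s)) - \<Phi> (of_real x))) {x..x + s}"
      by (rule fundamental_theorem_of_calculus)
         (use s \<Phi> in \<open>auto intro!: has_vector_derivative_real_field\<close>)
    have hi: "h integrable_on {x..x + s}"
      using h_hk integrable_on_subinterval[of h UNIV x "x + s"] by (auto simp: integrable_on_def)
    have "norm (\<Phi> (of_real (x + s)) - \<Phi> (of_real x)) = norm (integral {x..x + s} (\<lambda>t. F (of_real t)))"
      using ftc by (simp add: integral_unique)
    also have "norm (integral {x..x + s} (\<lambda>t. F (of_real t))) \<le> integral {x..x + s} (\<lambda>t. K + h t)"
      using ftc hi K(2) by (intro Henstock_Kurzweil_Integration.integral_norm_bound_integral)
        (auto intro!: integrable_add simp: integrable_on_def[of "\<lambda>t. F (of_real t)"])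
    also have "\<dots> = K * s + integral {x..x + s} h"
      using hi s by (subst Henstock_Kurzweil_Integration.integral_add) auto
    also have "integral {x..x + s} h \<le> integral UNIV h"
      using hi h_hk h0 by (intro integral_subset_le) (auto simp: integrable_on_def)
    also have "integral UNIV h = N" using h_hk by (rule integral_unique)
    also have "K * s \<le> K" using K(1) s by (simp add: mult_left_le)
    finally show ?thesis by simp
  qed
  define C' where "C' = C * exp \<tau>"
  define D where "D = max (K + N) C' * exp \<tau>"
  have diff_bound: "norm (F (of_real x + of_real s) - F (of_real x)) \<le> D" if s: "0 \<le> s" "s \<le> 1" for x s
  proof -
    define H where "H = (\<lambda>z. \<Phi> (z + of_real s) - \<Phi> z)"
    have H_der: "(H has_field_derivative F (z + of_real s) - F z) (at z)" for z
      unfolding H_def using DERIV_shift[of \<Phi> "F (z + of_real s)" z "of_real s"] \<Phi>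
      by (auto intro!: derivative_intros)
    have H_hol: "H holomorphic_on UNIV"
      using H_der by (auto simp: holomorphic_on_def field_differentiable_def)
    have H_growth: "norm (H z) \<le> C' * exp (\<tau> * norm z)" for z
    proof -
      have "norm (\<Phi> (z + of_real s) - \<Phi> z) \<le> (C' * exp (\<tau> * norm z)) * norm (z + of_real s - z)"
      proof (rule field_differentiable_bound[of "cball z 1" \<Phi> F])
        fix w assume "w \<in> cball z 1"
        then have "norm w \<le> norm z + 1" using norm_triangle_ineq2[of w z]
          by (simp add: dist_norm norm_minus_commute)
        then have "\<tau> * norm w \<le> \<tau> * (norm z + 1)" using \<tau> by (intro mult_left_mono)
        then have "C * exp (\<tau> * norm w) \<le> C * exp (\<tau> * norm z + \<tau>)"
          using C0 by (intro mult_left_mono) (auto simp: algebra_simps)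
        then show "norm (F w) \<le> C' * exp (\<tau> * norm z)"
          using C[of w] by (simp add: C'_def exp_add mult_ac)
      qed (use s \<Phi> in \<open>auto simp: dist_norm intro: has_field_derivative_at_within\<close>)
      also have "\<dots> \<le> C' * exp (\<tau> * norm z)"
        using s C0 by (simp add: C'_def mult_left_le)
      finally show ?thesis by (simp add: H_def)
    qed
    have H_imag: "norm (H z) \<le> max (K + N) C' * exp (\<tau> * \<bar>Im z\<bar>)" for z
      using real_bound[OF s] by (intro bounded_on_reals_imp_growth[OF H_hol \<tau> H_growth]) (simp add: H_def)
    have mx: "0 \<le> max (K + N) C'" using C0 by (simp add: C'_def le_max_iff_disj)
    have "norm ((deriv ^^ 1) H (of_real x)) \<le> fact 1 * D / 1 ^ 1"
    proof (rule Cauchy_inequality[where f = H and \<xi> = "of_real x" and r = 1 and B = D and n = 1])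
      fix w :: complex assume w: "norm (of_real x - w :: complex) = 1"
      have "\<bar>Im w\<bar> \<le> 1" using abs_Im_le_cmod[of "of_real x - w"] w by simp
      then have "exp (\<tau> * \<bar>Im w\<bar>) \<le> exp \<tau>" using \<tau> by (simp add: mult_left_le)
      then have "max (K + N) C' * exp (\<tau> * \<bar>Im w\<bar>) \<le> D"
        unfolding D_def using mx by (intro mult_left_mono)
      then show "norm (H w) \<le> D" using H_imag[of w] by linarith
    next
      show "H holomorphic_on ball (of_real x) 1"
        by (rule holomorphic_on_subset[OF H_hol]) simp
      show "continuous_on (cball (of_real x) 1) H"
        by (rule holomorphic_on_imp_continuous_on[OF holomorphic_on_subset[OF H_hol]]) simp
    qed simp
    moreover have "deriv H (of_real x) = F (of_real x + of_real s) - F (of_real x)"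
      by (rule DERIV_imp_deriv) (rule H_der)
    ultimately show ?thesis by simp
  qed
  have "norm (F (of_real x)) \<le> D + (K + N)" for x
  proof -
    \<comment> \<open>\<Psi> 1 - \<Psi> 0 is the mean of F over [x, x + 1] minus F x.\<close>
    define \<Psi> where "\<Psi> = (\<lambda>w. \<Phi> (of_real x + w) - w * F (of_real x))"
    have "norm (\<Psi> 1 - \<Psi> 0) \<le> D * norm (1 - 0 :: complex)"
    proof (rule field_differentiable_bound[of "closed_segment 0 1"])
      fix w :: complex
      have "((\<lambda>w. \<Phi> (of_real x + w)) has_field_derivative F (of_real x + w)) (at w)"
        using DERIV_shift[of \<Phi> "F (w + of_real x)" w "of_real x"] \<Phi>[of "w + of_real x"]
        by (simp add: add.commute)
      moreover have "((\<lambda>w. w * F (of_real x)) has_field_derivative F (of_real x)) (at w)"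
        by (rule derivative_eq_intros refl | simp)+
      ultimately have "(\<Psi> has_field_derivative F (of_real x + w) - F (of_real x)) (at w)"
        unfolding \<Psi>_def by (rule DERIV_diff)
      then show "(\<Psi> has_field_derivative F (of_real x + w) - F (of_real x)) (at w within closed_segment 0 1)"
        by (rule has_field_derivative_at_within)
    next
      fix w :: complex assume "w \<in> closed_segment 0 1"
      then obtain s where "0 \<le> s" "s \<le> 1" "w = of_real s"
        by (auto simp: in_segment scaleR_conv_of_real)
      then show "norm (F (of_real x + w) - F (of_real x)) \<le> D" using diff_bound by simp
    qed auto
    then have "norm (\<Phi> (of_real x + 1) - F (of_real x) - \<Phi> (of_real x)) \<le> D"
      by (simp add: \<Psi>_def)
    moreover have "norm (\<Phi> (of_real x + 1) - \<Phi> (of_real x)) \<le> K + N" using real_bound[of 1 x] by simp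
    ultimately have "norm (\<Phi> (of_real x + 1) - \<Phi> (of_real x)
        - (\<Phi> (of_real x + 1) - F (of_real x) - \<Phi> (of_real x))) \<le> D + (K + N)"
      using norm_triangle_ineq4[of "\<Phi> (of_real x + 1) - \<Phi> (of_real x)"
          "\<Phi> (of_real x + 1) - F (of_real x) - \<Phi> (of_real x)"] by linarith
    then show ?thesis by simp
  qed
  then show ?thesis by (rule that)
qed

lemma exp_type_Lp_growth:
  assumes F: "F \<in> exp_type_Lp \<sigma> p a" and p: "1 \<le> p" and a: "0 \<le> a" and \<sigma>: "0 < \<sigma>" and \<epsilon>: "0 < \<epsilon>"
  obtains C where "0 \<le> C" "\<And>z. norm (F z) \<le> C * exp ((\<sigma> + \<epsilon>) * \<bar>Im z\<bar>)"
proof -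
  obtain B where B: "\<And>x. norm (F (of_real x)) \<le> B"
    by (rule exp_type_Lp_bounded_on_reals[OF F p a \<sigma>]) blast
  obtain C where C: "\<And>z. norm (F z) \<le> C * exp ((\<sigma> + \<epsilon>) * norm z)" and hol: "F holomorphic_on UNIV"
    using F \<epsilon> unfolding exp_type_Lp_def exp_type_le_def by blast
  have "0 \<le> C" using C[of 0] by (simp add: order_trans[OF norm_ge_zero])
  then show ?thesis
    using bounded_on_reals_imp_growth[OF hol _ C B] \<sigma> \<epsilon> by (intro that[of "max B C"]) auto
qed

section \<open>Damping by powers of the sinc function\<close>

definition csinc :: "complex \<Rightarrow> complex" where
  "csinc z = (if z = 0 then 1 else sin z / z)"

lemma csinc_holomorphic: "csinc holomorphic_on A"
proof -
  have "deriv sin (0::complex) = 1" by (simp add: DERIV_imp_deriv[OF DERIV_sin])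
  then have "csinc = (\<lambda>z. if z = 0 then deriv sin 0 else (sin z - sin 0) / (z - 0))"
    by (auto simp: csinc_def fun_eq_iff)
  then have "csinc holomorphic_on UNIV"
    using pole_lemma_open[of sin UNIV 0] holomorphic_on_sin by simp
  then show ?thesis by (rule holomorphic_on_subset) simp
qed

lemma norm_cos_sin_le:
  fixes z :: complex
  shows "norm (cos z) \<le> exp \<bar>Im z\<bar>" "norm (sin z) \<le> exp \<bar>Im z\<bar>"
proof -
  have e: "norm (exp (\<i> * z)) \<le> exp \<bar>Im z\<bar>" "norm (exp (- (\<i> * z))) \<le> exp \<bar>Im z\<bar>"
    by (simp_all add: norm_exp_eq_Re)
  have "norm (cos z) = norm (exp (\<i> * z) + exp (- (\<i> * z))) / 2"
    by (simp add: cos_exp_eq norm_divide)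
  also have "\<dots> \<le> exp \<bar>Im z\<bar>"
    using norm_triangle_ineq[of "exp (\<i> * z)" "exp (- (\<i> * z))"] e by linarith
  finally show "norm (cos z) \<le> exp \<bar>Im z\<bar>" .
  have "norm (sin z) = norm (exp (\<i> * z) - exp (- (\<i> * z))) / 2"
    by (simp add: sin_exp_eq norm_divide norm_mult)
  also have "\<dots> \<le> exp \<bar>Im z\<bar>"
    using norm_triangle_ineq4[of "exp (\<i> * z)" "exp (- (\<i> * z))"] e by linarith
  finally show "norm (sin z) \<le> exp \<bar>Im z\<bar>" .
qed

lemma norm_csinc_le: "norm (csinc z) \<le> exp \<bar>Im z\<bar>"
proof -
  have "norm (sin z - sin 0) \<le> exp \<bar>Im z\<bar> * norm (z - 0)"
  proof (rule field_differentiable_bound[of "closed_segment 0 z" sin cos])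
    show "(sin has_field_derivative cos w) (at w within closed_segment 0 z)" for w :: complex
      by (auto intro!: derivative_eq_intros)
    fix w assume "w \<in> closed_segment 0 z"
    then obtain u where "0 \<le> u" "u \<le> 1" "w = u *\<^sub>R z" by (auto simp: in_segment)
    then have "\<bar>Im w\<bar> \<le> \<bar>Im z\<bar>" by (simp add: abs_mult mult_left_le_one_le)
    then show "norm (cos w) \<le> exp \<bar>Im z\<bar>"
      using norm_cos_sin_le(1)[of w] by (meson exp_le_cancel_iff order_trans)
  qed auto
  then show ?thesis by (auto simp: csinc_def norm_divide divide_simps)
qed

lemma csinc_decay: "norm (csinc z) * (1 + norm z) \<le> 2 * exp \<bar>Im z\<bar>"
proof -
  have "norm (csinc z) * norm z \<le> exp \<bar>Im z\<bar>"
    using norm_cos_sin_le(2)[of z] by (auto simp: csinc_def norm_divide)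
  then show ?thesis using norm_csinc_le[of z] by (simp add: algebra_simps)
qed

text \<open>
  The dilation lowers the type of \<open>F\<close> to about \<open>(1 - 2 * \<epsilon>) * \<sigma>\<close>; this leaves room for the factor
  \<open>csinc (\<epsilon> * \<sigma> / m * z) ^ m\<close> of type \<open>\<epsilon> * \<sigma>\<close>, which decays like \<open>\<bar>x\<bar> ^ (- m)\<close> on the real axis.
\<close>

definition damped_dilation :: "real \<Rightarrow> nat \<Rightarrow> (complex \<Rightarrow> complex) \<Rightarrow> real \<Rightarrow> complex \<Rightarrow> complex" where
  "damped_dilation \<sigma> m F \<epsilon> z =
     F (of_real (1 - 2 * \<epsilon>) * z) * csinc (of_real (\<epsilon> * \<sigma> / real m) * z) ^ m"

lemma damped_dilation_holomorphic:
  assumes "F holomorphic_on UNIV"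
  shows "damped_dilation \<sigma> m F \<epsilon> holomorphic_on UNIV"
proof -
  have "(\<lambda>z. H (c * z)) holomorphic_on UNIV" if "H holomorphic_on UNIV" for H and c :: complex
    using holomorphic_on_compose_gen[of "(*) c" UNIV H UNIV] that by (simp add: o_def holomorphic_intros)
  from this[OF assms] this[OF csinc_holomorphic] show ?thesis
    unfolding damped_dilation_def by (intro holomorphic_intros)
qed

text \<open>
  The types add up to at most \<open>\<sigma>\<close>: the hypothesis on \<open>F\<close> gives \<open>(1 + \<epsilon>) * (1 - 2 * \<epsilon>) \<le> 1 - \<epsilon>\<close> times
  \<open>\<sigma>\<close> for the dilation, and the sinc factor adds \<open>\<epsilon> * \<sigma>\<close>.
\<close>

lemma damped_dilation_decay:
  assumes growth: "\<And>z. norm (F z) \<le> C * exp ((\<sigma> + \<epsilon> * \<sigma>) * \<bar>Im z\<bar>)"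
    and C: "0 \<le> C" and \<sigma>: "0 < \<sigma>" and \<epsilon>: "0 < \<epsilon>" "\<epsilon> < 1 / 2" and m: "0 < m"
  obtains C' where "0 \<le> C'"
    "\<And>z. norm (damped_dilation \<sigma> m F \<epsilon> z) * (1 + norm z) ^ m \<le> C' * exp (\<sigma> * \<bar>Im z\<bar>)"
proof -
  define \<kappa> where "\<kappa> = \<epsilon> * \<sigma> / real m"
  define \<mu> where "\<mu> = min 1 \<kappa>"
  have \<kappa>: "0 < \<kappa>" using \<sigma> \<epsilon> m by (simp add: \<kappa>_def)
  then have \<mu>: "0 < \<mu>" "\<mu> \<le> 1" "\<mu> \<le> \<kappa>" by (simp_all add: \<mu>_def)
  have "norm (damped_dilation \<sigma> m F \<epsilon> z) * (1 + norm z) ^ m \<le> C * (2 / \<mu>) ^ m * exp (\<sigma> * \<bar>Im z\<bar>)" for z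
  proof -
    let ?y = "\<bar>Im z\<bar>"
    have "norm (F (of_real (1 - 2 * \<epsilon>) * z)) \<le> C * exp ((\<sigma> + \<epsilon> * \<sigma>) * ((1 - 2 * \<epsilon>) * ?y))"
      using growth[of "of_real (1 - 2 * \<epsilon>) * z"] \<epsilon> by (simp add: abs_mult)
    also have "(\<sigma> + \<epsilon> * \<sigma>) * ((1 - 2 * \<epsilon>) * ?y) \<le> (1 - \<epsilon>) * \<sigma> * ?y"
    proof -
      have "(1 + \<epsilon>) * (1 - 2 * \<epsilon>) \<le> 1 - \<epsilon>" using \<epsilon> by (simp add: algebra_simps)
      then have "((1 + \<epsilon>) * (1 - 2 * \<epsilon>)) * (\<sigma> * ?y) \<le> (1 - \<epsilon>) * (\<sigma> * ?y)"
        using \<sigma> by (intro mult_right_mono) auto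
      then show ?thesis by (simp add: algebra_simps)
    qed
    finally have 1: "norm (F (of_real (1 - 2 * \<epsilon>) * z)) \<le> C * exp ((1 - \<epsilon>) * \<sigma> * ?y)"
      using C by (simp add: mult_left_mono)
    have "norm (csinc (of_real \<kappa> * z)) * (\<mu> * (1 + norm z)) \<le> norm (csinc (of_real \<kappa> * z)) * (1 + norm (of_real \<kappa> * z))"
      using \<mu> \<kappa> mult_right_mono[OF \<mu>(3), of "norm z"]
      by (intro mult_left_mono) (auto simp: norm_mult algebra_simps)
    also have "\<dots> \<le> 2 * exp (\<kappa> * ?y)"
      using csinc_decay[of "of_real \<kappa> * z"] \<kappa> by (simp add: abs_mult)
    finally have "norm (csinc (of_real \<kappa> * z)) * (1 + norm z) \<le> 2 / \<mu> * exp (\<kappa> * ?y)"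
      using \<mu> by (simp add: field_simps)
    then have "(norm (csinc (of_real \<kappa> * z)) * (1 + norm z)) ^ m \<le> (2 / \<mu> * exp (\<kappa> * ?y)) ^ m"
      by (intro power_mono) auto
    also have "(2 / \<mu> * exp (\<kappa> * ?y)) ^ m = (2 / \<mu>) ^ m * exp (\<epsilon> * \<sigma> * ?y)"
    proof -
      have "exp (\<kappa> * ?y) ^ m = exp (real m * (\<kappa> * ?y))" by (rule exp_of_nat_mult[symmetric])
      also have "real m * (\<kappa> * ?y) = \<epsilon> * \<sigma> * ?y" using m by (simp add: \<kappa>_def)
      finally show ?thesis by (simp only: power_mult_distrib)
    qed
    finally have 2: "norm (csinc (of_real \<kappa> * z)) ^ m * (1 + norm z) ^ m \<le> (2 / \<mu>) ^ m * exp (\<epsilon> * \<sigma> * ?y)"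
      by (simp only: power_mult_distrib)
    have "norm (damped_dilation \<sigma> m F \<epsilon> z) * (1 + norm z) ^ m
        = norm (F (of_real (1 - 2 * \<epsilon>) * z)) * (norm (csinc (of_real \<kappa> * z)) ^ m * (1 + norm z) ^ m)"
      by (simp only: damped_dilation_def norm_mult norm_power \<kappa>_def mult.assoc)
    also have "\<dots> \<le> (C * exp ((1 - \<epsilon>) * \<sigma> * ?y)) * ((2 / \<mu>) ^ m * exp (\<epsilon> * \<sigma> * ?y))"
      using C by (intro mult_mono[OF 1 2]) auto
    also have "\<dots> = C * (2 / \<mu>) ^ m * (exp ((1 - \<epsilon>) * \<sigma> * ?y) * exp (\<epsilon> * \<sigma> * ?y))" by (simp only: mult_ac)
    also have "exp ((1 - \<epsilon>) * \<sigma> * ?y) * exp (\<epsilon> * \<sigma> * ?y) = exp (\<sigma> * ?y)"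
      by (simp add: exp_add[symmetric] algebra_simps)
    finally show ?thesis .
  qed
  then show ?thesis using C \<mu> by (intro that[of "C * (2 / \<mu>) ^ m"]) auto
qed

section \<open>Periodization of decaying entire functions\<close>

lemma summable_on_int_inverse_squares: "(\<lambda>j::int. 1 / (1 + \<bar>real_of_int j\<bar>)\<^sup>2) summable_on UNIV"
proof -
  let ?f = "\<lambda>j::int. 1 / (1 + \<bar>real_of_int j\<bar>)\<^sup>2"
  have s: "(\<lambda>n::nat. 1 / (1 + real n)\<^sup>2) summable_on UNIV"
  proof -
    have "summable (\<lambda>n. inverse (real (Suc n) ^ 2))"
      using inverse_power_summable[of 2, where 'a = real] by (subst summable_Suc_iff) auto
    then show ?thesis
      by (subst summable_on_UNIV_nonneg_real_iff) (auto simp: inverse_eq_divide)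
  qed
  have 1: "?f summable_on range int"
    using s by (subst summable_on_reindex) (auto simp: o_def inj_on_def)
  have 2: "?f summable_on range (\<lambda>n. - int n)"
    using s by (subst summable_on_reindex) (auto simp: o_def inj_on_def)
  have "(UNIV :: int set) = range int \<union> (range (\<lambda>n. - int n) - range int)"
    by (auto simp: image_iff) (metis int_cases2)
  moreover have "?f summable_on range int \<union> (range (\<lambda>n. - int n) - range int)"
    using 1 summable_on_subset_banach[OF 2] by (intro summable_on_Un_disjoint) auto
  ultimately show ?thesis by simp
qed

definition int_inverse_squares_sum :: real where
  "int_inverse_squares_sum = (\<Sum>\<^sub>\<infinity>j::int. 1 / (1 + \<bar>real_of_int j\<bar>)\<^sup>2)"

lemma int_inverse_squares_sum_nonneg: "0 \<le> int_inverse_squares_sum"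
  unfolding int_inverse_squares_sum_def by (intro infsum_nonneg) auto

lemma norm_infsum_le_int_inverse_squares:
  fixes u :: "int \<Rightarrow> complex"
  assumes le: "\<And>j. j \<in> A \<Longrightarrow> norm (u j) \<le> B * (1 / (1 + \<bar>real_of_int j\<bar>)\<^sup>2)" and B: "0 \<le> B"
  shows "u summable_on A" "norm (infsum u A) \<le> B * int_inverse_squares_sum"
proof -
  let ?b = "\<lambda>j::int. B * (1 / (1 + \<bar>real_of_int j\<bar>)\<^sup>2)"
  have b: "?b summable_on UNIV" using summable_on_int_inverse_squares by (rule summable_on_cmult_right)
  then have bA: "?b summable_on A" by (rule summable_on_subset_banach) simp
  have abs: "(\<lambda>j. norm (u j)) summable_on A"
    using bA by (rule summable_on_comparison_test) (use le in auto)
  then show "u summable_on A" by (rule abs_summable_summable)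
  have "norm (infsum u A) \<le> infsum (\<lambda>j. norm (u j)) A" by (rule norm_infsum_bound[OF abs])
  also have "\<dots> \<le> infsum ?b UNIV"
    using B by (intro infsum_mono_neutral[OF abs b]) (use le in auto)
  also have "\<dots> = B * int_inverse_squares_sum"
    unfolding int_inverse_squares_sum_def by (rule infsum_cmult_right) (use summable_on_int_inverse_squares in auto)
  finally show "norm (infsum u A) \<le> B * int_inverse_squares_sum" .
qed

definition periodization :: "real \<Rightarrow> (complex \<Rightarrow> complex) \<Rightarrow> complex \<Rightarrow> complex" where
  "periodization L G z = (\<Sum>\<^sub>\<infinity>j::int. G (z + of_int j * of_real L))"

lemma periodization_shift: "periodization L G (z + of_int i * of_real L) = periodization L G z"
proof -
  have "bij_betw (\<lambda>j::int. i + j) UNIV UNIV" by (rule bij_plus_right[unfolded bij_def, folded bij_def] | simp)+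
  from infsum_reindex_bij_betw[OF this, of "\<lambda>j. G (z + of_int j * of_real L)"] show ?thesis
    unfolding periodization_def by (simp add: algebra_simps)
qed

text \<open>
  In the fundamental interval \<open>[- L / 2, L / 2]\<close> a translate by a lattice point is at least as far from
  the origin as \<open>x\<close> itself, and at least half as far as the lattice point. The first estimate carries
  the decay of \<open>G\<close> over to its periodization, the second makes the series converge.
\<close>

lemma lattice_distance:
  fixes x L :: real and j :: int
  assumes x: "\<bar>x\<bar> \<le> L / 2"
  shows "\<bar>x\<bar> \<le> \<bar>x + of_int j * L\<bar>" "\<bar>of_int j\<bar> * L / 2 \<le> \<bar>x + of_int j * L\<bar>"
proof -
  have L: "0 \<le> L" using x by linarith
  have *: "\<bar>of_int j\<bar> * L - \<bar>x\<bar> \<le> \<bar>x + of_int j * L\<bar>"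
    using L abs_triangle_ineq2[of "of_int j * L" "- x"] by (simp add: abs_mult add.commute)
  show "\<bar>x\<bar> \<le> \<bar>x + of_int j * L\<bar>"
  proof (cases "j = 0")
    case False
    then have "1 * L \<le> \<bar>of_int j\<bar> * L" using L by (intro mult_right_mono) linarith+
    then show ?thesis using * x by linarith
  qed simp
  then show "\<bar>of_int j\<bar> * L / 2 \<le> \<bar>x + of_int j * L\<bar>" using * by linarith
qed

text \<open>
  The two extra powers in the decay condition are spent on the convergence of the periodization; the
  other \<open>k\<close> survive as its decay on the fundamental interval.
\<close>

locale decaying_entire =
  fixes G :: "complex \<Rightarrow> complex" and C \<sigma> :: real and k :: nat
  assumes hol: "G holomorphic_on UNIV" and C0: "0 \<le> C" and \<sigma>: "0 < \<sigma>"
    and decay: "\<And>z. norm (G z) * (1 + norm z) ^ (k + 2) \<le> C * exp (\<sigma> * \<bar>Im z\<bar>)"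
begin

lemma term_bound:
  assumes "1 + r \<le> 1 + norm z" "0 \<le> r" "s \<le> 1 + norm z" "0 < s" "\<bar>Im z\<bar> = y"
  shows "norm (G z) \<le> C * exp (\<sigma> * y) / ((1 + r) ^ k * s\<^sup>2)"
proof -
  have "(1 + r) ^ k * s\<^sup>2 \<le> (1 + norm z) ^ k * (1 + norm z)\<^sup>2"
    using assms by (intro mult_mono power_mono) auto
  also have "\<dots> = (1 + norm z) ^ (k + 2)" by (simp add: power_add power2_eq_square)
  finally have "norm (G z) * ((1 + r) ^ k * s\<^sup>2) \<le> C * exp (\<sigma> * y)"
    using decay[of z] assms(5) by (meson mult_left_mono norm_ge_zero order_trans)
  then show ?thesis using assms by (simp add: pos_le_divide_eq)
qed

text \<open>
  Locally uniform convergence by the Weierstrass test: on a disc of radius \<open>R\<close> Peetre's inequality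
  \<open>1 + \<bar>j L\<bar> \<le> (1 + \<bar>z + j L\<bar>) * (1 + \<bar>z\<bar>)\<close> compares the terms with \<open>1 / (1 + \<bar>j\<bar>)\<^sup>2\<close>.
\<close>

lemma periodization_holomorphic:
  assumes L: "2 \<le> L"
  shows "periodization L G holomorphic_on UNIV"
proof -
  have "periodization L G holomorphic_on ball 0 R" if R: "0 < R" for R
  proof -
    define B where "B = C * exp (\<sigma> * R) * (1 + R)\<^sup>2"
    have bound: "norm (G (z + of_int j * of_real L)) \<le> B * (1 / (1 + \<bar>real_of_int j\<bar>)\<^sup>2)" if z: "z \<in> cball 0 R" for z j
    proof -
      let ?w = "z + of_int j * of_real L"
      have "\<bar>real_of_int j\<bar> \<le> \<bar>real_of_int j\<bar> * L" using L by (simp add: mult_le_cancel_left1)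
      also have "\<dots> = norm (of_int j * of_real L :: complex)" using L by (simp add: norm_mult)
      also have "\<dots> \<le> norm ?w + norm z" using norm_triangle_ineq4[of ?w z] by simp
      finally have "1 + \<bar>real_of_int j\<bar> \<le> (1 + norm ?w) * (1 + norm z)"
        using mult_nonneg_nonneg[OF norm_ge_zero[of ?w] norm_ge_zero[of z]]
        by (simp only: distrib_left distrib_right mult_1 mult_1_right)
      also have "\<dots> \<le> (1 + norm ?w) * (1 + R)" using z by (intro mult_left_mono) auto
      finally have s: "(1 + \<bar>real_of_int j\<bar>) / (1 + R) \<le> 1 + norm ?w" using R by (simp add: pos_divide_le_eq)
      have "norm (G ?w) \<le> C * exp (\<sigma> * \<bar>Im z\<bar>) / ((1 + 0) ^ k * ((1 + \<bar>real_of_int j\<bar>) / (1 + R))\<^sup>2)"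
        using R s by (intro term_bound) auto
      also have "\<dots> = C * exp (\<sigma> * \<bar>Im z\<bar>) * ((1 + R)\<^sup>2 / (1 + \<bar>real_of_int j\<bar>)\<^sup>2)" 
        by (simp add: power_divide)
      also have "\<dots> \<le> C * exp (\<sigma> * R) * ((1 + R)\<^sup>2 / (1 + \<bar>real_of_int j\<bar>)\<^sup>2)"
        using C0 \<sigma> z abs_Im_le_cmod[of z] by (intro mult_right_mono mult_left_mono) auto
      finally show ?thesis by (simp add: B_def)
    qed
    have ul: "uniform_limit (cball 0 R) (\<lambda>X z. \<Sum>j\<in>X. G (z + of_int j * of_real L)) (periodization L G) (finite_subsets_at_top UNIV)"
      unfolding periodization_def
      by (rule Weierstrass_m_test_general[OF bound
            summable_on_cmult_right[OF summable_on_int_inverse_squares]])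
    have G_shift: "(\<lambda>z. G (z + c)) holomorphic_on S" for c S
      using holomorphic_on_compose_gen[of "\<lambda>z. z + c" S G UNIV] hol by (simp add: o_def holomorphic_intros)
    show ?thesis
    proof (rule holomorphic_uniform_limit[OF _ ul])
      show "\<forall>\<^sub>F X in finite_subsets_at_top UNIV. continuous_on (cball 0 R) (\<lambda>z. \<Sum>j\<in>X. G (z + of_int j * of_real L))
          \<and> (\<lambda>z. \<Sum>j\<in>X. G (z + of_int j * of_real L)) holomorphic_on ball 0 R"
        by (intro always_eventually allI conjI continuous_on_sum holomorphic_on_sum
            holomorphic_on_imp_continuous_on[OF G_shift] G_shift)
    qed auto
  qed
  then have "periodization L G field_differentiable at z" for z
    using holomorphic_on_imp_differentiable_at[of "periodization L G" "ball 0 (norm z + 1)" z]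
    by (simp add: add_nonneg_pos)
  then show ?thesis by (simp add: holomorphic_on_def field_differentiable_at_within)
qed

lemma periodization_bound:
  assumes L: "2 \<le> L" and z: "\<bar>Re z\<bar> \<le> L / 2"
  shows "(\<lambda>j::int. G (z + of_int j * of_real L)) summable_on UNIV"
    and "norm (periodization L G z) \<le> C * exp (\<sigma> * \<bar>Im z\<bar>) / (1 + \<bar>Re z\<bar>) ^ k * int_inverse_squares_sum"
proof -
  have "norm (G (z + of_int j * of_real L)) \<le>
      C * exp (\<sigma> * \<bar>Im z\<bar>) / (1 + \<bar>Re z\<bar>) ^ k * (1 / (1 + \<bar>real_of_int j\<bar>)\<^sup>2)" for j :: int
  proof -
    have re: "\<bar>Re z + of_int j * L\<bar> \<le> norm (z + of_int j * of_real L)"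
      using abs_Re_le_cmod[of "z + of_int j * of_real L"] by simp
    have "\<bar>real_of_int j\<bar> * 2 \<le> \<bar>real_of_int j\<bar> * L" using L by (intro mult_left_mono) auto
    then have "norm (G (z + of_int j * of_real L)) \<le>
       C * exp (\<sigma> * \<bar>Im z\<bar>) / ((1 + \<bar>Re z\<bar>) ^ k * (1 + \<bar>real_of_int j\<bar>)\<^sup>2)"
      using lattice_distance[OF z, of j] re by (intro term_bound) auto
    then show ?thesis by simp
  qed
  from norm_infsum_le_int_inverse_squares[of UNIV, OF this]
  show "(\<lambda>j::int. G (z + of_int j * of_real L)) summable_on UNIV"
    "norm (periodization L G z) \<le> C * exp (\<sigma> * \<bar>Im z\<bar>) / (1 + \<bar>Re z\<bar>) ^ k * int_inverse_squares_sum"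
    using C0 unfolding periodization_def by auto
qed

lemma periodization_approx:
  assumes L: "2 \<le> L" and x: "\<bar>x\<bar> \<le> L / 2"
  shows "norm (periodization L G (of_real x) - G (of_real x)) \<le> 16 * C * int_inverse_squares_sum / L\<^sup>2"
proof -
  let ?u = "\<lambda>j::int. G (of_real x + of_int j * of_real L)"
  have "(?u has_sum periodization L G (of_real x)) UNIV"
    unfolding periodization_def using periodization_bound(1)[OF L, of "of_real x"] x by simp
  moreover have "(?u has_sum ?u 0) {0}" using has_sum_finite[of "{0}" ?u] by simp
  ultimately have "(?u has_sum (periodization L G (of_real x) - ?u 0)) (UNIV - {0})"
    by (rule has_sum_Diff) simp
  then have "periodization L G (of_real x) - G (of_real x) = infsum ?u (UNIV - {0})"
    by (simp add: infsumI)
  also have "norm \<dots> \<le> (16 * C / L\<^sup>2) * int_inverse_squares_sum"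
  proof (rule norm_infsum_le_int_inverse_squares(2))
    fix j :: int assume j: "j \<in> UNIV - {0}"
    have re: "\<bar>x + of_int j * L\<bar> \<le> norm (of_real x + of_int j * of_real L :: complex)"
      using abs_Re_le_cmod[of "of_real x + of_int j * of_real L"] by simp
    have "1 \<le> \<bar>real_of_int j\<bar>" using j by auto
    then have "(1 + \<bar>real_of_int j\<bar>) * (L / 4) \<le> (2 * \<bar>real_of_int j\<bar>) * (L / 4)"
      using L by (intro mult_right_mono) auto
    then have s: "(1 + \<bar>real_of_int j\<bar>) * (L / 4) \<le> 1 + norm (of_real x + of_int j * of_real L :: complex)"
    proof -
      have "(2 * \<bar>real_of_int j\<bar>) * (L / 4) = \<bar>real_of_int j\<bar> * L / 2" by simp
      then show ?thesis
        using lattice_distance(2)[OF x, of j] re \<open>(1 + \<bar>real_of_int j\<bar>) * (L / 4) \<le> (2 * \<bar>real_of_int j\<bar>) * (L / 4)\<close>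
        by linarith
    qed
    have "norm (?u j) \<le> C * exp (\<sigma> * 0) / ((1 + 0) ^ k * ((1 + \<bar>real_of_int j\<bar>) * (L / 4))\<^sup>2)"
      using s L by (intro term_bound) (auto simp: add_pos_nonneg)
    also have "\<dots> = 16 * C / L\<^sup>2 * (1 / (1 + \<bar>real_of_int j\<bar>)\<^sup>2)"
      by (simp add: power_mult_distrib power_divide mult_ac)
    finally show "norm (?u j) \<le> 16 * C / L\<^sup>2 * (1 / (1 + \<bar>real_of_int j\<bar>)\<^sup>2)" .
  qed (use C0 in auto)
  finally show ?thesis by simp
qed

lemma periodization_trig_poly:
  assumes n: "1 \<le> n" and L: "L = 2 * pi * real n / \<sigma>" "2 \<le> L"
  shows "(\<lambda>t. periodization L G (of_real (real n / \<sigma> * t))) \<in> trig_polys n"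
proof -
  define c where "c = (of_real (real n / \<sigma>) :: complex)"
  define U where "U = (\<lambda>z. periodization L G (c * z))"
  have "(\<lambda>t. U (of_real t)) \<in> trig_polys n"
  proof (rule entire_periodic_imp_trig_poly)
    show "U holomorphic_on UNIV" unfolding U_def
      using holomorphic_on_compose_gen[of "(*) c" UNIV "periodization L G" UNIV] periodization_holomorphic[OF L(2)]
      by (simp add: o_def holomorphic_intros)
    show "U (z + 2 * of_real pi) = U z" for z
    proof -
      have "c * (z + 2 * of_real pi) = c * z + of_int 1 * of_real L"
        by (simp add: c_def L(1) algebra_simps)
      then show ?thesis by (simp only: U_def periodization_shift)
    qed
    show "norm (U z) \<le> C * int_inverse_squares_sum * exp (real n * \<bar>Im z\<bar>)" for z
    proof -
      define r where "r = Re (c * z)"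
      \<comment> \<open>Translation by the lattice point i L brings z into the fundamental strip.\<close>
      define i where "i = - round (r / L)"
      define w where "w = c * z + of_int i * of_real L"
      have Re_w: "Re w = r - of_int (round (r / L)) * L" by (simp add: w_def r_def i_def)
      have "\<bar>of_int (round (r / L)) - r / L\<bar> * L \<le> 1 / 2 * L"
        using L(2) of_int_round_abs_le[of "r / L"] by (intro mult_right_mono) auto
      moreover have "\<bar>of_int (round (r / L)) - r / L\<bar> * L = \<bar>Re w\<bar>"
      proof -
        have "\<bar>of_int (round (r / L)) - r / L\<bar> * L = \<bar>(of_int (round (r / L)) - r / L) * L\<bar>"
          using L(2) by (simp add: abs_mult)
        also have "(of_int (round (r / L)) - r / L) * L = - Re w"
          using L(2) by (simp add: Re_w left_diff_distrib)
        finally show ?thesis by simp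
      qed
      ultimately have "\<bar>Re w\<bar> \<le> L / 2" by simp
      from periodization_bound(2)[OF L(2) this]
      have "norm (U z) \<le> C * exp (\<sigma> * \<bar>Im w\<bar>) / (1 + \<bar>Re w\<bar>) ^ k * int_inverse_squares_sum"
        unfolding U_def w_def periodization_shift .
      also have "\<dots> \<le> C * exp (\<sigma> * \<bar>Im w\<bar>) / 1 * int_inverse_squares_sum"
        using C0 int_inverse_squares_sum_nonneg
        by (intro mult_right_mono divide_left_mono) (auto simp: one_le_power)
      also have "\<sigma> * \<bar>Im w\<bar> = real n * \<bar>Im z\<bar>"
        using \<sigma> by (simp add: w_def c_def abs_mult)
      finally show ?thesis by (simp add: mult_ac)
    qed
  qed
  then show ?thesis by (simp add: U_def c_def)
qed

end

section \<open>Integrals with the power weight\<close>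

text \<open>
  Dominating functions that vary with \<open>i\<close> but whose integrals converge to that of their limit. The
  truncations \<open>min (u i) v'\<close> are covered by the usual theorem, and what they miss is at most
  \<open>max (v i - v') 0 = (v i - v') + max (v' - v i) 0\<close>, whose integral tends to \<open>0\<close> because the last term
  is dominated by \<open>v'\<close>.
\<close>

lemma generalized_dominated_convergence:
  fixes u v :: "nat \<Rightarrow> 'a \<Rightarrow> real" and u' v' :: "'a \<Rightarrow> real"
  assumes [measurable]: "\<And>i. u i \<in> borel_measurable M" "u' \<in> borel_measurable M"
    and v_int: "\<And>i. integrable M (v i)" "integrable M v'"
    and le: "\<And>i x. 0 \<le> u i x" "\<And>i x. u i x \<le> v i x"
    and lim: "AE x in M. (\<lambda>i. u i x) \<longlonglongrightarrow> u' x" "AE x in M. (\<lambda>i. v i x) \<longlonglongrightarrow> v' x"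
    and int_lim: "(\<lambda>i. integral\<^sup>L M (v i)) \<longlonglongrightarrow> integral\<^sup>L M v'"
  shows "(\<lambda>i. integral\<^sup>L M (u i)) \<longlonglongrightarrow> integral\<^sup>L M u'"
proof -
  have [measurable]: "v i \<in> borel_measurable M" "v' \<in> borel_measurable M" for i using v_int by auto
  have v0: "0 \<le> v i x" for i x using le[of i x] by linarith
  have v'0: "AE x in M. 0 \<le> v' x" using lim(2) by eventually_elim (rule LIMSEQ_le_const, auto simp: v0)
  have u_int: "integrable M (u i)" for i
    by (rule Bochner_Integration.integrable_bound[OF v_int(1)[of i]]) (use le v0 in auto)
  have 1: "(\<lambda>i. \<integral>x. min (u i x) (v' x) \<partial>M) \<longlonglongrightarrow> (\<integral>x. u' x \<partial>M)"
  proof (rule integral_dominated_convergence[OF _ _ v_int(2)])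
    show "AE x in M. (\<lambda>i. min (u i x) (v' x)) \<longlonglongrightarrow> u' x"
      using lim
    proof eventually_elim
      case (elim x)
      have "u' x \<le> v' x" by (rule LIMSEQ_le[OF elim]) (use le in auto)
      then show ?case using tendsto_min[OF elim(1) tendsto_const[of "v' x"]] by (simp add: min_absorb1)
    qed
    show "AE x in M. norm (min (u i x) (v' x)) \<le> v' x" for i
      using v'0 by eventually_elim (use le in \<open>auto simp: min_def\<close>)
  qed auto
  have 2: "(\<lambda>i. \<integral>x. max (v' x - v i x) 0 \<partial>M) \<longlonglongrightarrow> (\<integral>x. 0 \<partial>M)"
  proof (rule integral_dominated_convergence[OF _ _ v_int(2)])
    show "AE x in M. (\<lambda>i. max (v' x - v i x) 0) \<longlonglongrightarrow> 0"
      using lim(2)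
    proof eventually_elim
      case (elim x)
      then show ?case using tendsto_max[OF tendsto_diff[OF tendsto_const[of "v' x"] elim] tendsto_const[of 0]] by simp
    qed
    show "AE x in M. norm (max (v' x - v i x) 0) \<le> v' x" for i
      using v'0 by eventually_elim (use v0 in \<open>auto simp: max_def\<close>)
  qed auto
  have neg_int: "integrable M (\<lambda>x. max (v' x - v i x) 0)" for i
    using v_int by (intro integrable_max integrable_diff) auto
  have min_int: "integrable M (\<lambda>x. min (u i x) (v' x))" for i
    using v_int u_int by (intro integrable_min) auto
  define b where "b = (\<lambda>i. (\<integral>x. min (u i x) (v' x) \<partial>M) + ((integral\<^sup>L M (v i) - integral\<^sup>L M v') + (\<integral>x. max (v' x - v i x) 0 \<partial>M)))"
  have "b \<longlonglongrightarrow> (\<integral>x. u' x \<partial>M) + ((integral\<^sup>L M v' - integral\<^sup>L M v') + (\<integral>x. 0 \<partial>M))"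
    unfolding b_def by (intro tendsto_add tendsto_diff 1 2 int_lim tendsto_const)
  then have b_lim: "b \<longlonglongrightarrow> (\<integral>x. u' x \<partial>M)" by simp
  have lower: "(\<integral>x. min (u i x) (v' x) \<partial>M) \<le> integral\<^sup>L M (u i)" for i
    using min_int u_int by (intro integral_mono) auto
  have upper: "integral\<^sup>L M (u i) \<le> b i" for i
  proof -
    have "integral\<^sup>L M (u i) \<le> (\<integral>x. min (u i x) (v' x) + ((v i x - v' x) + max (v' x - v i x) 0) \<partial>M)"
    proof (rule integral_mono)
      show "u i x \<le> min (u i x) (v' x) + ((v i x - v' x) + max (v' x - v i x) 0)" for x
        using le(2)[of i x] by (auto simp: min_def max_def)
    qed (use u_int min_int v_int neg_int in auto)
    also have "\<dots> = b i" unfolding b_def using min_int v_int neg_int by simp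
    finally show ?thesis .
  qed
  show ?thesis
    by (rule tendsto_sandwich[OF _ _ 1 b_lim]) (use lower upper in auto)
qed

lemma norm_diff_powr_le:
  fixes x y :: "'a :: real_normed_vector"
  assumes "0 \<le> p"
  shows "norm (x - y) powr p \<le> 2 powr p * (norm x powr p + norm y powr p)"
proof -
  define m where "m = max (norm x) (norm y)"
  have "norm (x - y) \<le> 2 * m" unfolding m_def using norm_triangle_ineq4[of x y] by linarith
  then have "norm (x - y) powr p \<le> (2 * m) powr p" using assms by (intro powr_mono2) auto
  also have "\<dots> = 2 powr p * m powr p" by (simp add: powr_mult m_def le_max_iff_disj)
  also have "m powr p \<le> norm x powr p + norm y powr p" unfolding m_def by (simp add: max_def)
  finally show ?thesis by (simp add: mult_left_mono)
qed

lemma integrable_inverse_square_abs: "integrable lebesgue (\<lambda>x::real. 1 / (1 + \<bar>x\<bar>)\<^sup>2)"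
proof -
  define g where "g = (\<lambda>x::real. indicator {0..} x * (1 / (1 + x)\<^sup>2))"
  have [measurable]: "g \<in> borel_measurable borel" unfolding g_def by measurable
  have "(\<integral>\<^sup>+x. ennreal (1 / (1 + x)\<^sup>2) * indicator {0..} x \<partial>lborel) = ennreal (0 - (- 1 / (1 + 0)))"
  proof (rule nn_integral_FTC_atLeast)
    show "((\<lambda>x::real. - 1 / (1 + x)) \<longlongrightarrow> 0) at_top" by real_asymp
    show "((\<lambda>x. - 1 / (1 + x)) has_real_derivative 1 / (1 + x)\<^sup>2) (at x)" if "0 \<le> x" for x :: real
      using that by (auto intro!: derivative_eq_intros simp: power2_eq_square)
  qed auto
  moreover have "(\<integral>\<^sup>+x. ennreal (g x) \<partial>lborel) = (\<integral>\<^sup>+x. ennreal (1 / (1 + x)\<^sup>2) * indicator {0..} x \<partial>lborel)"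
    unfolding g_def by (intro nn_integral_cong) (auto simp: indicator_def)
  ultimately have "(\<integral>\<^sup>+x. ennreal (g x) \<partial>lborel) < \<infinity>" by simp
  then have g: "integrable lborel g" by (intro integrableI_nonneg) (auto simp: g_def)
  then have g': "integrable lborel (\<lambda>x. g (0 + (- 1) * x))" by (rule lborel_integrable_real_affine) simp
  have "integrable lborel (\<lambda>x::real. 1 / (1 + \<bar>x\<bar>)\<^sup>2)"
    by (rule Bochner_Integration.integrable_bound[OF Bochner_Integration.integrable_add[OF g g']])
       (auto simp: g_def indicator_def)
  then show ?thesis by (simp add: integrable_completion)
qed

lemma Lp_power_dilation:
  assumes g: "g \<in> Lp_power p a" and c: "0 < c"
  shows "integrable lebesgue (\<lambda>x. norm (g (c * x)) powr p * power_weight a x)"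
    and "(LINT x|lebesgue. norm (g (c * x)) powr p * power_weight a x)
       = c powr (- (2 * a + 1)) * (LINT x|lebesgue. norm (g x) powr p * power_weight a x)"
proof -
  let ?h = "\<lambda>x. norm (g x) powr p * power_weight a x"
  have h: "integrable lebesgue ?h" using g by (simp add: Lp_power_def)
  have eq: "norm (g (c * x)) powr p * power_weight a x = c powr (- (2 * a)) * ?h (0 + c * x)" for x
    using c by (simp add: power_weight_def abs_mult powr_mult powr_minus)
  show "integrable lebesgue (\<lambda>x. norm (g (c * x)) powr p * power_weight a x)"
    unfolding eq using lebesgue_integrable_real_affine[OF h, of c 0] c by simp
  have "(LINT x|lebesgue. ?h x) = c * (LINT x|lebesgue. ?h (0 + c * x))"
    using lebesgue_integral_real_affine[of c ?h 0] c by simp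
  moreover have "c powr (- (2 * a + 1)) * c = c powr (- (2 * a))"
    using c by (simp add: powr_diff powr_minus powr_add field_simps)
  moreover have "(LINT x|lebesgue. norm (g (c * x)) powr p * power_weight a x)
      = c powr (- (2 * a)) * (LINT x|lebesgue. ?h (0 + c * x))"
    unfolding eq by (rule integral_mult_right_zero)
  ultimately show "(LINT x|lebesgue. norm (g (c * x)) powr p * power_weight a x)
       = c powr (- (2 * a + 1)) * (LINT x|lebesgue. ?h x)"
    by (simp only: mult.assoc[symmetric])
qed

lemma Lp_power_diff:
  assumes f: "f \<in> Lp_power p a" and g: "g \<in> Lp_power p a" and p: "0 \<le> p"
  shows "(\<lambda>x. f x - g x) \<in> Lp_power p a"
proof -
  have [measurable]: "f \<in> borel_measurable lebesgue" "g \<in> borel_measurable lebesgue"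
    using f g by (auto simp: Lp_power_def)
  have [measurable]: "power_weight a \<in> borel_measurable lebesgue"
    unfolding power_weight_def by (rule measurable_completion) measurable
  have "integrable lebesgue (\<lambda>x. 2 powr p * (norm (f x) powr p * power_weight a x + norm (g x) powr p * power_weight a x))"
    using f g by (auto simp: Lp_power_def)
  then have "integrable lebesgue (\<lambda>x. norm (f x - g x) powr p * power_weight a x)"
  proof (rule Bochner_Integration.integrable_bound)
    show "AE x in lebesgue. norm (norm (f x - g x) powr p * power_weight a x)
        \<le> norm (2 powr p * (norm (f x) powr p * power_weight a x + norm (g x) powr p * power_weight a x))"
      using mult_right_mono[OF norm_diff_powr_le[OF p, of "f x" "g x" for x], of "power_weight a x" for x]
      by (intro AE_I2) (simp add: power_weight_def algebra_simps)
  qed measurable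
  then show ?thesis by (simp add: Lp_power_def)
qed

lemma continuous_on_real_restriction:
  assumes "F holomorphic_on UNIV"
  shows "continuous_on UNIV (\<lambda>x::real. F (of_real x))"
  by (intro continuous_on_compose2[OF holomorphic_on_imp_continuous_on[OF assms]] continuous_intros) auto

lemma measurable_real_restriction:
  assumes "F holomorphic_on UNIV"
  shows "(\<lambda>x::real. F (of_real x)) \<in> borel_measurable borel"
  using continuous_on_real_restriction[OF assms] by (rule borel_measurable_continuous_onI)

lemma power_weight_measurable [measurable]: "power_weight a \<in> borel_measurable borel"
  unfolding power_weight_def by measurable

lemma power_weight_nonneg: "0 \<le> power_weight a x"
  by (simp add: power_weight_def)

lemma lebesgue_measurable_of_borel:
  "g \<in> borel_measurable borel \<Longrightarrow> g \<in> borel_measurable lebesgue"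
  by (rule measurable_completion) simp

lemma norm_damped_dilation_real_le:
  "norm (damped_dilation \<sigma> m F \<epsilon> (of_real x)) \<le> norm (F (of_real ((1 - 2 * \<epsilon>) * x)))"
proof -
  have "norm (csinc (of_real (\<epsilon> * \<sigma> / real m) * of_real x)) \<le> 1"
    using norm_csinc_le[of "of_real (\<epsilon> * \<sigma> / real m) * of_real x"] by simp
  then have "norm (csinc (of_real (\<epsilon> * \<sigma> / real m) * of_real x)) ^ m \<le> 1"
    by (intro power_le_one) auto
  then show ?thesis
    by (simp add: damped_dilation_def norm_mult norm_power mult_left_le)
qed

lemma damped_dilation_tendsto:
  assumes hol: "F holomorphic_on UNIV" and \<epsilon>: "\<epsilon> \<longlonglongrightarrow> 0"
  shows "(\<lambda>i. damped_dilation \<sigma> m F (\<epsilon> i) z) \<longlonglongrightarrow> F z"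
proof -
  have "continuous_on UNIV F" "continuous_on UNIV csinc"
    using hol csinc_holomorphic by (auto intro: holomorphic_on_imp_continuous_on)
  then have "isCont F (of_real (1 - 2 * 0) * z)" "isCont csinc (of_real (0 * \<sigma> / real m) * z)"
    by (simp_all add: continuous_on_eq_continuous_at)
  then have "(\<lambda>i. F (of_real (1 - 2 * \<epsilon> i) * z) * csinc (of_real (\<epsilon> i * \<sigma> / real m) * z) ^ m)
      \<longlonglongrightarrow> F (of_real (1 - 2 * 0) * z) * csinc (of_real (0 * \<sigma> / real m) * z) ^ m"
    unfolding divide_inverse
    by (intro tendsto_mult tendsto_power isCont_tendsto_compose[of _ F] isCont_tendsto_compose[of _ csinc]
        tendsto_of_real tendsto_diff tendsto_const \<epsilon>)
  then show ?thesis by (simp add: damped_dilation_def csinc_def)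
qed

text \<open>
  The natural majorant contains the dilation \<open>F ((1 - 2 * \<epsilon> i) * x)\<close>, which depends on \<open>i\<close>; its weighted
  integral is known by scaling and converges, so the generalized dominated convergence theorem applies.
\<close>

lemma damped_dilation_error_tendsto:
  assumes f: "f \<in> Lp_power p a" and F: "F \<in> exp_type_Lp \<sigma> p a" and p: "0 < p"
    and \<epsilon>: "\<epsilon> \<longlonglongrightarrow> 0" "\<And>i. \<epsilon> i < 1 / 2"
  shows "(\<lambda>i. LINT x|lebesgue. norm (f x - damped_dilation \<sigma> m F (\<epsilon> i) (of_real x)) powr p * power_weight a x)
     \<longlonglongrightarrow> (LINT x|lebesgue. norm (f x - F (of_real x)) powr p * power_weight a x)"
proof -
  define FR where "FR = (\<lambda>x::real. F (of_real x))"
  have hol: "F holomorphic_on UNIV" and FL: "FR \<in> Lp_power p a"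
    using F by (auto simp: exp_type_Lp_def exp_type_le_def FR_def)
  have [measurable]: "f \<in> borel_measurable lebesgue" using f by (simp add: Lp_power_def)
  have [measurable]: "(\<lambda>x. H (of_real x)) \<in> borel_measurable lebesgue" if "H holomorphic_on UNIV" for H :: "complex \<Rightarrow> complex"
    by (rule lebesgue_measurable_of_borel[OF measurable_real_restriction[OF that]])
  note meas = this
  have [measurable]: "power_weight a \<in> borel_measurable lebesgue"
    by (rule lebesgue_measurable_of_borel) measurable
  have c: "0 < 1 - 2 * \<epsilon> i" for i using \<epsilon>(2)[of i] by simp
  let ?If = "\<lambda>x. norm (f x) powr p * power_weight a x"
  let ?IF = "\<lambda>c x. norm (FR (c * x)) powr p * power_weight a x"
  have If: "integrable lebesgue ?If" using f by (simp add: Lp_power_def)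
  show ?thesis
  proof (rule generalized_dominated_convergence)
    show "(\<lambda>x. norm (f x - damped_dilation \<sigma> m F (\<epsilon> i) (of_real x)) powr p * power_weight a x) \<in> borel_measurable lebesgue" for i
      using meas[OF damped_dilation_holomorphic[OF hol, of \<sigma> m "\<epsilon> i"]] by measurable
    show "(\<lambda>x. norm (f x - F (of_real x)) powr p * power_weight a x) \<in> borel_measurable lebesgue"
      using meas[OF hol] by measurable
    show "integrable lebesgue (\<lambda>x. 2 powr p * (?If x + ?IF (1 - 2 * \<epsilon> i) x))" for i
      using If Lp_power_dilation(1)[OF FL c[of i]] by simp
    show "integrable lebesgue (\<lambda>x. 2 powr p * (?If x + ?IF 1 x))"
      using If Lp_power_dilation(1)[OF FL zero_less_one] by simp
    show "0 \<le> norm (f x - damped_dilation \<sigma> m F (\<epsilon> i) (of_real x)) powr p * power_weight a x" for i x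
      by (simp add: power_weight_nonneg)
    show "norm (f x - damped_dilation \<sigma> m F (\<epsilon> i) (of_real x)) powr p * power_weight a x
       \<le> 2 powr p * (?If x + ?IF (1 - 2 * \<epsilon> i) x)" for i x
    proof -
      have "norm (f x - damped_dilation \<sigma> m F (\<epsilon> i) (of_real x)) powr p
          \<le> 2 powr p * (norm (f x) powr p + norm (damped_dilation \<sigma> m F (\<epsilon> i) (of_real x)) powr p)"
        using p by (intro norm_diff_powr_le) simp
      also have "\<dots> \<le> 2 powr p * (norm (f x) powr p + norm (FR ((1 - 2 * \<epsilon> i) * x)) powr p)"
        using norm_damped_dilation_real_le[of \<sigma> m F "\<epsilon> i" x] p unfolding FR_def
        by (intro mult_left_mono add_left_mono powr_mono2) auto
      finally show ?thesis
        using mult_right_mono[OF _ power_weight_nonneg[of a x]] by (fastforce simp: algebra_simps)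
    qed
    show "AE x in lebesgue. (\<lambda>i. norm (f x - damped_dilation \<sigma> m F (\<epsilon> i) (of_real x)) powr p * power_weight a x)
       \<longlonglongrightarrow> norm (f x - F (of_real x)) powr p * power_weight a x"
      using p by (intro AE_I2 tendsto_mult tendsto_powr' tendsto_norm tendsto_diff tendsto_const
          damped_dilation_tendsto[OF hol \<epsilon>(1)]) auto
    have FR_lim: "(\<lambda>i. FR ((1 - 2 * \<epsilon> i) * x)) \<longlonglongrightarrow> FR (1 * x)" for x
    proof (rule isCont_tendsto_compose[of _ FR])
      show "isCont FR (1 * x)"
        using continuous_on_real_restriction[OF hol] by (simp add: FR_def continuous_on_eq_continuous_at)
      have "(\<lambda>i. (1 - 2 * \<epsilon> i) * x) \<longlonglongrightarrow> (1 - 2 * 0) * x"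
        by (intro tendsto_intros \<epsilon>(1))
      then show "(\<lambda>i. (1 - 2 * \<epsilon> i) * x) \<longlonglongrightarrow> 1 * x" by simp
    qed
    show "AE x in lebesgue. (\<lambda>i. 2 powr p * (?If x + ?IF (1 - 2 * \<epsilon> i) x)) \<longlonglongrightarrow> 2 powr p * (?If x + ?IF 1 x)"
      using p by (intro AE_I2 tendsto_mult tendsto_add tendsto_powr' tendsto_norm tendsto_const FR_lim) auto
    have "(\<lambda>i. 2 powr p * (integral\<^sup>L lebesgue ?If + (1 - 2 * \<epsilon> i) powr (- (2 * a + 1)) * integral\<^sup>L lebesgue (?IF 1)))
        \<longlonglongrightarrow> 2 powr p * (integral\<^sup>L lebesgue ?If + (1 - 2 * 0) powr (- (2 * a + 1)) * integral\<^sup>L lebesgue (?IF 1))"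
      by (intro tendsto_intros \<epsilon>(1)) auto
    then show "(\<lambda>i. LINT x|lebesgue. 2 powr p * (?If x + ?IF (1 - 2 * \<epsilon> i) x))
       \<longlonglongrightarrow> (LINT x|lebesgue. 2 powr p * (?If x + ?IF 1 x))"
      using If Lp_power_dilation[OF FL c] Lp_power_dilation(1)[OF FL zero_less_one] by simp
  qed
qed

section \<open>Rescaling the periodic problem\<close>

text \<open>
  The periodic weight in the variable \<open>x = r * t\<close>, normalized so as to approach \<open>\<bar>x\<bar> powr (2 * a)\<close>.
\<close>

definition scaled_weight :: "real \<Rightarrow> real \<Rightarrow> real \<Rightarrow> real \<Rightarrow> real" where
  "scaled_weight a b r x = r powr (2 * a) * jacobi_weight a b (x / r)"

lemma scaled_weight_nonneg: "0 \<le> scaled_weight a b r x"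
  by (simp add: scaled_weight_def jacobi_weight_nonneg)

lemma scaled_weight_measurable [measurable]: "scaled_weight a b r \<in> borel_measurable borel"
  unfolding scaled_weight_def by measurable

lemma scaled_weight_le:
  assumes "0 \<le> a" "0 \<le> b" "0 < r"
  shows "scaled_weight a b r x \<le> power_weight a x"
proof -
  have "scaled_weight a b r x \<le> r powr (2 * a) * \<bar>x / r\<bar> powr (2 * a)"
    unfolding scaled_weight_def using assms by (intro mult_left_mono jacobi_weight_le) auto
  also have "\<dots> = power_weight a x"
    using assms by (simp add: power_weight_def powr_divide)
  finally show ?thesis .
qed

lemma scaled_weight_tendsto:
  assumes x: "x \<noteq> 0" and r: "filterlim r at_top F"
  shows "((\<lambda>i. scaled_weight a b (r i) x) \<longlongrightarrow> power_weight a x) F"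
proof -
  have pos: "\<forall>\<^sub>F i in F. 0 < r i" using r by (simp add: filterlim_at_top_dense)
  have small: "((\<lambda>i. x / r i / 2) \<longlongrightarrow> 0) F"
  proof -
    have "((\<lambda>i. x / r i) \<longlongrightarrow> 0) F"
      by (rule tendsto_divide_0[OF tendsto_const filterlim_at_top_imp_at_infinity[OF r]])
    then show ?thesis using tendsto_divide[OF _ tendsto_const[of 2]] by fastforce
  qed
  have "((\<lambda>y::real. sin y / y) \<longlongrightarrow> 1) (at 0)"
    using DERIV_sin[of "0::real"] by (simp add: has_field_derivative_iff)
  then have s: "((\<lambda>i. sin (x / r i / 2) / (x / r i / 2)) \<longlongrightarrow> 1) F"
  proof (rule filterlim_compose)
    show "filterlim (\<lambda>i. x / r i / 2) (at 0) F"
      unfolding filterlim_at using small pos x by (auto elim!: eventually_mono)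
  qed
  have c: "((\<lambda>i. cos (x / r i / 2)) \<longlongrightarrow> cos 0) F"
    by (rule isCont_tendsto_compose[OF _ small]) simp
  have "((\<lambda>i. (\<bar>x\<bar> * \<bar>sin (x / r i / 2) / (x / r i / 2)\<bar>) powr (2 * a) * \<bar>cos (x / r i / 2)\<bar> powr (2 * b))
      \<longlongrightarrow> (\<bar>x\<bar> * \<bar>1\<bar>) powr (2 * a) * \<bar>cos 0\<bar> powr (2 * b)) F"
    using x by (intro tendsto_mult tendsto_powr tendsto_rabs tendsto_const s c) auto
  moreover have "\<forall>\<^sub>F i in F. (\<bar>x\<bar> * \<bar>sin (x / r i / 2) / (x / r i / 2)\<bar>) powr (2 * a) * \<bar>cos (x / r i / 2)\<bar> powr (2 * b)
      = scaled_weight a b (r i) x"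
    using pos
  proof eventually_elim
    case (elim i)
    have "\<bar>x\<bar> * \<bar>sin (x / r i / 2) / (x / r i / 2)\<bar> = r i * \<bar>2 * sin (x / r i / 2)\<bar>"
      using elim x by (simp add: abs_mult)
    then show ?case using elim by (simp add: scaled_weight_def jacobi_weight_def powr_mult)
  qed
  ultimately show ?thesis
    by (simp add: power_weight_def tendsto_cong)
qed

text \<open>
  The \<open>p\<close>-th power of the error of \<open>T\<close> in the variable \<open>x = r * t\<close>.
\<close>

definition scaled_error :: "real \<Rightarrow> real \<Rightarrow> real \<Rightarrow> (real \<Rightarrow> complex) \<Rightarrow> real \<Rightarrow> (real \<Rightarrow> complex) \<Rightarrow> real" where
  "scaled_error a b p f r T = (LINT x|lebesgue. indicat_real {- (pi * r)..pi * r} x *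
     (norm (f x - T (x / r)) powr p * scaled_weight a b r x))"

lemma scaled_error_eq:
  assumes r: "0 < r"
  shows "r powr (2 * a + 1) * (LINT t:{-pi..pi}|lebesgue. norm (f (r * t) - T t) powr p * jacobi_weight a b t)
     = scaled_error a b p f r T"
proof -
  have "scaled_error a b p f r T = r * (LINT x|lebesgue. indicat_real {- (pi * r)..pi * r} (0 + r * x) *
     (norm (f (0 + r * x) - T ((0 + r * x) / r)) powr p * scaled_weight a b r (0 + r * x)))"
    unfolding scaled_error_def using r by (subst lebesgue_integral_real_affine[of r _ 0]) auto
  also have "(\<lambda>x. indicat_real {- (pi * r)..pi * r} (0 + r * x) *
     (norm (f (0 + r * x) - T ((0 + r * x) / r)) powr p * scaled_weight a b r (0 + r * x)))
    = (\<lambda>x. r powr (2 * a) * (indicat_real {-pi..pi} x *\<^sub>R (norm (f (r * x) - T x) powr p * jacobi_weight a b x)))"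
  proof
    fix x
    have "0 + r * x \<in> {- (pi * r)..pi * r} \<longleftrightarrow> x \<in> {-pi..pi}"
    proof -
      have "- (pi * r) = r * (- pi)" "pi * r = r * pi" by simp_all
      then show ?thesis using r by (simp only: atLeastAtMost_iff add_0 mult_le_cancel_left_pos)
    qed
    then have "indicat_real {- (pi * r)..pi * r} (0 + r * x) = indicat_real {-pi..pi} x"
      by (simp add: indicator_def)
    then show "indicat_real {- (pi * r)..pi * r} (0 + r * x) *
        (norm (f (0 + r * x) - T ((0 + r * x) / r)) powr p * scaled_weight a b r (0 + r * x))
      = r powr (2 * a) * (indicat_real {-pi..pi} x *\<^sub>R (norm (f (r * x) - T x) powr p * jacobi_weight a b x))"
      using r by (simp add: scaled_weight_def)
  qed
  also have "r * (LINT x|lebesgue. r powr (2 * a) * (indicat_real {-pi..pi} x *\<^sub>R (norm (f (r * x) - T x) powr p * jacobi_weight a b x)))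
    = r powr (2 * a + 1) * (LINT t:{-pi..pi}|lebesgue. norm (f (r * t) - T t) powr p * jacobi_weight a b t)"
    unfolding set_lebesgue_integral_def using r by (subst integral_mult_right_zero) (simp add: powr_add)
  finally show ?thesis by simp
qed

lemma scaled_error_nonneg: "0 \<le> scaled_error a b p f r T"
  unfolding scaled_error_def
  by (rule Bochner_Integration.integral_nonneg) (simp add: scaled_weight_nonneg)

lemma trig_polys_zero: "(\<lambda>t. 0) \<in> trig_polys n"
  unfolding trig_polys_def by (auto intro!: exI[of _ "\<lambda>_. 0"])

lemma scaled_periodic_error_eq:
  assumes r: "0 < r" and p: "0 < p"
  shows "r powr ((2 * a + 1) / p) *
      (LINT t:{-pi..pi}|lebesgue. norm (f (r * t) - T t) powr p * jacobi_weight a b t) powr (1 / p)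
    = scaled_error a b p f r T powr (1 / p)"
proof -
  have "0 \<le> (LINT t:{-pi..pi}|lebesgue. norm (f (r * t) - T t) powr p * jacobi_weight a b t)"
    unfolding set_lebesgue_integral_def
    by (rule Bochner_Integration.integral_nonneg) (simp add: jacobi_weight_nonneg)
  then show ?thesis
    unfolding scaled_error_eq[OF r, symmetric] using r by (simp add: powr_mult powr_powr)
qed

lemma scaled_periodic_error_le:
  assumes n: "1 \<le> n" and \<sigma>: "0 < \<sigma>" and p: "0 < p" and T: "T \<in> trig_polys n"
  shows "(real n / \<sigma>) powr ((2 * a + 1) / p) * periodic_error n \<sigma> f p a b
     \<le> scaled_error a b p f (real n / \<sigma>) T powr (1 / p)"
proof -
  have r: "0 < real n / \<sigma>" using n \<sigma> by simp
  have "periodic_error n \<sigma> f p a b \<le>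
     (LINT t:{-pi..pi}|lebesgue. norm (f (real n / \<sigma> * t) - T t) powr p * jacobi_weight a b t) powr (1 / p)"
    unfolding periodic_error_def by (rule cINF_lower[OF bdd_belowI2[of _ 0] T]) simp
  then show ?thesis
    unfolding scaled_periodic_error_eq[OF r p, symmetric] by (intro mult_left_mono) auto
qed

lemma scaled_periodic_error_less_imp:
  assumes n: "1 \<le> n" and \<sigma>: "0 < \<sigma>" and p: "0 < p"
    and less: "(real n / \<sigma>) powr ((2 * a + 1) / p) * periodic_error n \<sigma> f p a b < R"
  obtains T where "T \<in> trig_polys n" "scaled_error a b p f (real n / \<sigma>) T powr (1 / p) < R"
proof -
  have r: "0 < real n / \<sigma>" using n \<sigma> by simp
  define c where "c = (real n / \<sigma>) powr ((2 * a + 1) / p)"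
  have c: "0 < c" using n \<sigma> by (simp add: c_def)
  define g where "g = (\<lambda>T. (LINT t:{-pi..pi}|lebesgue.
      norm (f (real n / \<sigma> * t) - T t) powr p * jacobi_weight a b t) powr (1 / p))"
  have "(INF T\<in>trig_polys n. g T) < R / c"
    using less c unfolding c_def[symmetric] periodic_error_def g_def
    by (simp add: pos_less_divide_eq mult.commute)
  moreover have "trig_polys n \<noteq> {}" using trig_polys_zero by blast
  moreover have "bdd_below (g ` trig_polys n)" by (rule bdd_belowI2[of _ 0]) (simp add: g_def)
  ultimately obtain T where T: "T \<in> trig_polys n" "g T < R / c"
    using cINF_less_iff by metis
  have "c * (LINT t:{-pi..pi}|lebesgue. norm (f (real n / \<sigma> * t) - T t) powr p * jacobi_weight a b t) powr (1 / p) < R"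
    using T(2) c unfolding g_def by (simp add: pos_less_divide_eq mult.commute)
  then show ?thesis
    unfolding c_def scaled_periodic_error_eq[OF r p] by (rule that[OF T(1)])
qed

section \<open>The limit is at most the error on the line\<close>

context decaying_entire
begin

text \<open>
  Dominated convergence: the periodizations converge pointwise to \<open>G\<close>, and on the growing intervals
  they obey the same decay \<open>(1 + \<bar>x\<bar>) ^ (- k)\<close>, with a fixed constant. The condition on \<open>k\<close> makes the
  majorant, weighted by \<open>\<bar>x\<bar> powr (2 * a)\<close>, at most a multiple of \<open>(1 + \<bar>x\<bar>) ^ (- 2)\<close>.
\<close>

lemma scaled_error_periodization_tendsto:
  assumes f: "f \<in> Lp_power p a" and p: "1 \<le> p" and ab: "0 \<le> a" "0 \<le> b" and k: "2 * a + 2 \<le> real k"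
  shows "(\<lambda>n. scaled_error a b p f (real n / \<sigma>)
      (\<lambda>t. periodization (2 * pi * real n / \<sigma>) G (of_real (real n / \<sigma> * t))))
    \<longlonglongrightarrow> (LINT x|lebesgue. norm (f x - G (of_real x)) powr p * power_weight a x)"
proof -
  define r where "r = (\<lambda>n. real n / \<sigma>)"
  define P where "P = (\<lambda>n x::real. periodization (2 * pi * r n) G (of_real x))"
  define D where "D = C * int_inverse_squares_sum"
  have D0: "0 \<le> D" unfolding D_def using C0 int_inverse_squares_sum_nonneg by simp
  have r_top: "filterlim r at_top sequentially"
    unfolding r_def divide_inverse using \<sigma>
    by (intro filterlim_tendsto_pos_mult_at_top[OF tendsto_const _ filterlim_real_sequentially, of "inverse \<sigma>",
          unfolded mult.commute[of "inverse \<sigma>"]]) auto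
  have "\<forall>\<^sub>F n in sequentially. 1 \<le> r n" using r_top by (simp add: filterlim_at_top)
  \<comment> \<open>For small n the period 2 pi r may be below 2, where the bounds on the periodization do not
    hold, so the argument runs over the indices n \<ge> N.\<close>
  then obtain N where N: "\<And>n. N \<le> n \<Longrightarrow> 1 \<le> r n" by (auto simp: eventually_sequentially)
  have L: "2 \<le> 2 * pi * r n" if "N \<le> n" for n
  proof -
    have "2 * 1 * 1 \<le> 2 * pi * r n" using N[OF that] pi_gt3 by (intro mult_mono) auto
    then show ?thesis by simp
  qed
  have P_bound: "norm (P n x) \<le> D / (1 + \<bar>x\<bar>) ^ k" if "N \<le> n" "\<bar>x\<bar> \<le> pi * r n" for n x
    using periodization_bound(2)[OF L[OF that(1)], of "of_real x"] that(2) by (simp add: P_def D_def)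
  have P_approx: "norm (P n x - G (of_real x)) \<le> 16 * D / (2 * pi * r n)\<^sup>2" if "N \<le> n" "\<bar>x\<bar> \<le> pi * r n" for n x
    using periodization_approx[OF L[OF that(1)], of x] that(2) by (simp add: P_def D_def mult.assoc)
  have P_lim: "(\<lambda>n. P n x) \<longlonglongrightarrow> G (of_real x)" for x
  proof (rule LIM_zero_cancel, rule Lim_null_comparison)
    have "\<forall>\<^sub>F n in sequentially. \<bar>x\<bar> \<le> r n" using r_top by (simp add: filterlim_at_top)
    then show "\<forall>\<^sub>F n in sequentially. norm (P n x - G (of_real x)) \<le> 16 * D / (2 * pi * r n)\<^sup>2"
      using eventually_ge_at_top[of N]
    proof eventually_elim
      case (elim n)
      have "1 * r n \<le> pi * r n" using N[OF elim(2)] pi_gt3 by (intro mult_right_mono) auto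
      then show ?case using elim by (intro P_approx) auto
    qed
    have "filterlim (\<lambda>n. 2 * pi * r n) at_top sequentially"
      by (rule filterlim_tendsto_pos_mult_at_top[OF tendsto_const _ r_top]) simp
    then have "filterlim (\<lambda>n. (2 * pi * r n)\<^sup>2) at_top sequentially"
      by (intro filterlim_pow_at_top) auto
    then show "(\<lambda>n. 16 * D / (2 * pi * r n)\<^sup>2) \<longlonglongrightarrow> 0"
      by (intro tendsto_divide_0[OF tendsto_const] filterlim_at_top_imp_at_infinity)
  qed
  define q where "q = (\<lambda>n x. indicat_real {- (pi * r n)..pi * r n} x * (norm (f x - P n x) powr p * scaled_weight a b (r n) x))"
  have q_eq: "integral\<^sup>L lebesgue (q n) = scaled_error a b p f (real n / \<sigma>)
      (\<lambda>t. periodization (2 * pi * real n / \<sigma>) G (of_real (real n / \<sigma> * t)))" if "N \<le> n" for n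
  proof -
    have rn: "real n / \<sigma> = r n" by (simp add: r_def)
    have "r n * (x / r n) = x" for x using N[OF that] by simp
    moreover have "2 * pi * real n / \<sigma> = 2 * pi * r n" by (simp add: r_def)
    ultimately show ?thesis
      unfolding q_def scaled_error_def P_def by (simp only: rn)
  qed
  have [measurable]: "f \<in> borel_measurable lebesgue" using f by (simp add: Lp_power_def)
  have [measurable]: "power_weight a \<in> borel_measurable lebesgue" "scaled_weight a b s \<in> borel_measurable lebesgue" for s
    by (auto intro: lebesgue_measurable_of_borel)
  have G_meas [measurable]: "(\<lambda>x. G (of_real x)) \<in> borel_measurable lebesgue"
    by (rule lebesgue_measurable_of_borel[OF measurable_real_restriction[OF hol]])
  define w where "w = (\<lambda>x. 2 powr p * (norm (f x) powr p * power_weight a x + D powr p * (1 / (1 + \<bar>x\<bar>)\<^sup>2)))"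
  have "(\<lambda>i. integral\<^sup>L lebesgue (q (i + N))) \<longlonglongrightarrow> (LINT x|lebesgue. norm (f x - G (of_real x)) powr p * power_weight a x)"
  proof (rule integral_dominated_convergence[where w = w])
    show "(\<lambda>x. norm (f x - G (of_real x)) powr p * power_weight a x) \<in> borel_measurable lebesgue" by measurable
    show "q (i + N) \<in> borel_measurable lebesgue" for i
    proof -
      have [measurable]: "P (i + N) \<in> borel_measurable lebesgue" unfolding P_def
        by (rule lebesgue_measurable_of_borel[OF measurable_real_restriction[OF periodization_holomorphic]])
           (rule L, simp)
      have [measurable]: "indicat_real {- (pi * r (i + N))..pi * r (i + N)} \<in> borel_measurable lebesgue"
        by (rule borel_measurable_indicator) auto
      show ?thesis unfolding q_def by measurable
    qed
    show "integrable lebesgue w"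
      unfolding w_def using f integrable_inverse_square_abs
      by (intro integrable_mult_right Bochner_Integration.integrable_add) (auto simp: Lp_power_def)
    have "AE x in lebesgue. x \<noteq> (0::real)" by (rule AE_completion[OF AE_lborel_singleton])
    then show "AE x in lebesgue. (\<lambda>i. q (i + N) x) \<longlonglongrightarrow> norm (f x - G (of_real x)) powr p * power_weight a x"
    proof eventually_elim
      case (elim x)
      have "(\<lambda>n. norm (f x - P n x) powr p * scaled_weight a b (r n) x) \<longlonglongrightarrow> norm (f x - G (of_real x)) powr p * power_weight a x"
        using p by (intro tendsto_mult tendsto_powr' tendsto_norm tendsto_diff tendsto_const P_lim
            scaled_weight_tendsto[OF elim r_top]) auto
      moreover have "\<forall>\<^sub>F n in sequentially. norm (f x - P n x) powr p * scaled_weight a b (r n) x = q n x"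
      proof -
        have "\<forall>\<^sub>F n in sequentially. \<bar>x\<bar> \<le> r n" using r_top by (simp add: filterlim_at_top)
        then show ?thesis
          using eventually_ge_at_top[of N]
        proof eventually_elim
          case (elim n)
          have "1 * r n \<le> pi * r n" using N[OF elim(2)] pi_gt3 by (intro mult_right_mono) auto
          then have "x \<in> {- (pi * r n)..pi * r n}" using elim by auto
          then show ?case by (simp add: q_def)
        qed
      qed
      ultimately have "(\<lambda>n. q n x) \<longlonglongrightarrow> norm (f x - G (of_real x)) powr p * power_weight a x"
        by (rule Lim_transform_eventually)
      then show ?case by (rule LIMSEQ_ignore_initial_segment)
    qed
    show "AE x in lebesgue. norm (q (i + N) x) \<le> w x" for i
    proof (intro AE_I2)
      fix x
      define n where "n = i + N"
      have n: "N \<le> n" by (simp add: n_def)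
      have w0: "0 \<le> w x" unfolding w_def by (simp add: power_weight_nonneg)
      show "norm (q (i + N) x) \<le> w x"
      proof (cases "x \<in> {- (pi * r n)..pi * r n}")
        case False
        then have "q n x = 0" by (simp add: q_def)
        then show ?thesis using w0 by (simp add: n_def)
      next
        case True
        then have x: "\<bar>x\<bar> \<le> pi * r n" by auto
        have y: "1 \<le> 1 + \<bar>x\<bar>" by simp
        have "norm (P n x) powr p \<le> (D / (1 + \<bar>x\<bar>) ^ k) powr p"
          using P_bound[OF n x] p by (intro powr_mono2) auto
        also have "\<dots> = D powr p / ((1 + \<bar>x\<bar>) ^ k) powr p" by (simp add: powr_divide)
        finally have 1: "norm (P n x) powr p * power_weight a x \<le> D powr p * (\<bar>x\<bar> powr (2 * a) / ((1 + \<bar>x\<bar>) ^ k) powr p)"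
          using mult_right_mono[OF _ power_weight_nonneg[of a x]] by (fastforce simp: power_weight_def)
        have "\<bar>x\<bar> powr (2 * a) * (1 + \<bar>x\<bar>)\<^sup>2 \<le> (1 + \<bar>x\<bar>) powr (2 * a) * (1 + \<bar>x\<bar>) powr 2"
          using ab by (intro mult_mono powr_mono2) (auto simp: powr_numeral)
        also have "\<dots> = (1 + \<bar>x\<bar>) powr (2 * a + 2)" by (simp add: powr_add)
        also have "\<dots> \<le> (1 + \<bar>x\<bar>) powr real k" using k y by (intro powr_mono) auto
        also have "\<dots> = (1 + \<bar>x\<bar>) ^ k" by (simp add: powr_realpow)
        also have "\<dots> \<le> ((1 + \<bar>x\<bar>) ^ k) powr p"
          using powr_mono[OF p one_le_power[OF y, of k]] by simp
        finally have "\<bar>x\<bar> powr (2 * a) / ((1 + \<bar>x\<bar>) ^ k) powr p \<le> 1 / (1 + \<bar>x\<bar>)\<^sup>2"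
          by (simp add: divide_simps)
        then have 2: "norm (P n x) powr p * power_weight a x \<le> D powr p * (1 / (1 + \<bar>x\<bar>)\<^sup>2)"
          using 1 by (meson mult_left_mono order_trans powr_ge_zero)
        have "norm (q n x) = norm (f x - P n x) powr p * scaled_weight a b (r n) x"
          using True by (simp add: q_def scaled_weight_nonneg abs_mult)
        also have "\<dots> \<le> norm (f x - P n x) powr p * power_weight a x"
          using scaled_weight_le[OF ab, of "r n" x] N[OF n] by (intro mult_left_mono) auto
        also have "\<dots> \<le> (2 powr p * (norm (f x) powr p + norm (P n x) powr p)) * power_weight a x"
          using p by (intro mult_right_mono norm_diff_powr_le power_weight_nonneg) auto
        also have "\<dots> = 2 powr p * (norm (f x) powr p * power_weight a x + norm (P n x) powr p * power_weight a x)"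
          by (simp add: algebra_simps)
        also have "\<dots> \<le> w x" unfolding w_def using 2 by (intro mult_left_mono add_left_mono) auto
        finally show ?thesis by (simp add: n_def)
      qed
    qed
  qed
  then have "(\<lambda>n. integral\<^sup>L lebesgue (q n)) \<longlonglongrightarrow> (LINT x|lebesgue. norm (f x - G (of_real x)) powr p * power_weight a x)"
    by (rule LIMSEQ_offset)
  moreover have "\<forall>\<^sub>F n in sequentially. integral\<^sup>L lebesgue (q n) = scaled_error a b p f (real n / \<sigma>)
      (\<lambda>t. periodization (2 * pi * real n / \<sigma>) G (of_real (real n / \<sigma> * t)))"
    using eventually_ge_at_top[of N] by eventually_elim (rule q_eq)
  ultimately show ?thesis by (rule Lim_transform_eventually)
qed

end

lemma exp_type_Lp_zero: "(\<lambda>_. 0) \<in> exp_type_Lp \<sigma> p a"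
  by (auto simp: exp_type_Lp_def exp_type_le_def Lp_power_def intro!: exI[of _ 0])

lemma line_error_le:
  assumes "F \<in> exp_type_Lp \<sigma> p a"
  shows "line_error \<sigma> f p a \<le> (LINT x|lebesgue. norm (f x - F (of_real x)) powr p * power_weight a x) powr (1 / p)"
  unfolding line_error_def by (rule cINF_lower[OF bdd_belowI2[of _ 0] assms]) simp

lemma line_error_less_imp:
  assumes "line_error \<sigma> f p a < R"
  obtains F where "F \<in> exp_type_Lp \<sigma> p a"
    "(LINT x|lebesgue. norm (f x - F (of_real x)) powr p * power_weight a x) powr (1 / p) < R"
proof -
  define g where "g = (\<lambda>F. (LINT x|lebesgue. norm (f x - F (complex_of_real x)) powr p * power_weight a x) powr (1 / p))"
  have "(INF F\<in>exp_type_Lp \<sigma> p a. g F) < R" using assms by (simp add: line_error_def g_def)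
  moreover have "exp_type_Lp \<sigma> p a \<noteq> {}" using exp_type_Lp_zero by blast
  moreover have "bdd_below (g ` exp_type_Lp \<sigma> p a)" by (rule bdd_belowI2[of _ 0]) (simp add: g_def)
  ultimately obtain F where "F \<in> exp_type_Lp \<sigma> p a" "g F < R" using cINF_less_iff by metis
  then show ?thesis unfolding g_def by (rule that)
qed

lemma eventually_scaled_periodic_error_less:
  assumes p: "1 \<le> p" and ab: "0 \<le> b" "b \<le> a" and \<sigma>: "0 < \<sigma>" and f: "f \<in> Lp_power p a"
    and R: "line_error \<sigma> f p a < R"
  shows "\<forall>\<^sub>F n in sequentially. (real n / \<sigma>) powr ((2 * a + 1) / p) * periodic_error n \<sigma> f p a b < R"
proof -
  have a: "0 \<le> a" and p0: "0 < p" using ab p by auto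
  obtain F where F: "F \<in> exp_type_Lp \<sigma> p a"
    "(LINT x|lebesgue. norm (f x - F (of_real x)) powr p * power_weight a x) powr (1 / p) < R"
    by (rule line_error_less_imp[OF R])
  have hol: "F holomorphic_on UNIV" using F by (auto simp: exp_type_Lp_def exp_type_le_def)
  define k where "k = nat \<lceil>2 * a + 2\<rceil>"
  have k: "2 * a + 2 \<le> real k" unfolding k_def by linarith
  define \<epsilon> where "\<epsilon> = (\<lambda>i. 1 / (real i + 3))"
  have \<epsilon>: "\<epsilon> \<longlonglongrightarrow> 0" "0 < \<epsilon> i" "\<epsilon> i < 1 / 2" for i
    unfolding \<epsilon>_def by (real_asymp, auto simp: field_simps)
  define J where "J = (\<lambda>H. LINT x|lebesgue. norm (f x - H (complex_of_real x)) powr p * power_weight a x)"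
  have "(\<lambda>i. J (damped_dilation \<sigma> (k + 2) F (\<epsilon> i)) powr (1 / p)) \<longlonglongrightarrow> J F powr (1 / p)"
    unfolding J_def using p0
    by (intro tendsto_powr' damped_dilation_error_tendsto[OF f F(1) p0 \<epsilon>(1,3)] tendsto_const)
       (auto intro!: always_eventually Bochner_Integration.integral_nonneg simp: power_weight_nonneg)
  then have "\<forall>\<^sub>F i in sequentially. J (damped_dilation \<sigma> (k + 2) F (\<epsilon> i)) powr (1 / p) < R"
    by (rule order_tendstoD(2)) (use F(2) in \<open>simp add: J_def\<close>)
  then obtain i where i: "J (damped_dilation \<sigma> (k + 2) F (\<epsilon> i)) powr (1 / p) < R"
    by (auto simp: eventually_sequentially)
  define G where "G = damped_dilation \<sigma> (k + 2) F (\<epsilon> i)"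
  obtain C where C: "0 \<le> C" "\<And>z. norm (F z) \<le> C * exp ((\<sigma> + \<epsilon> i * \<sigma>) * \<bar>Im z\<bar>)"
    using exp_type_Lp_growth[OF F(1) p a \<sigma>, of "\<epsilon> i * \<sigma>"] \<epsilon>(2)[of i] \<sigma> by auto
  obtain C' where C': "0 \<le> C'" "\<And>z. norm (G z) * (1 + norm z) ^ (k + 2) \<le> C' * exp (\<sigma> * \<bar>Im z\<bar>)"
    unfolding G_def by (rule damped_dilation_decay[OF C(2,1) \<sigma> \<epsilon>(2,3), where m = "k + 2"]) auto
  interpret decaying_entire G C' \<sigma> k
    by unfold_locales (use C' \<sigma> damped_dilation_holomorphic[OF hol] in \<open>auto simp: G_def\<close>)
  define T where "T = (\<lambda>n t. periodization (2 * pi * real n / \<sigma>) G (complex_of_real (real n / \<sigma> * t)))"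
  have "(\<lambda>n. scaled_error a b p f (real n / \<sigma>) (T n) powr (1 / p)) \<longlonglongrightarrow> J G powr (1 / p)"
    unfolding J_def T_def using p0
    by (intro tendsto_powr' scaled_error_periodization_tendsto[OF f p a ab(1) k] tendsto_const)
       (auto simp: scaled_error_nonneg)
  then have "\<forall>\<^sub>F n in sequentially. scaled_error a b p f (real n / \<sigma>) (T n) powr (1 / p) < R"
    by (rule order_tendstoD(2)) (use i in \<open>simp add: G_def\<close>)
  moreover have "\<forall>\<^sub>F n in sequentially. 2 \<le> 2 * pi * real n / \<sigma>"
    using \<sigma> by real_asymp
  ultimately show ?thesis
    using eventually_ge_at_top[of 1]
  proof eventually_elim
    case (elim n)
    have "T n \<in> trig_polys n"
      unfolding T_def by (rule periodization_trig_poly[OF elim(3) refl elim(2)])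
    from scaled_periodic_error_le[OF elim(3) \<sigma> p0 this, of a f b] elim(1) show ?case by simp
  qed
qed

section \<open>The limit is at least the error on the line\<close>

lemma scaled_error_integrable:
  assumes f: "f \<in> Lp_power p a" and p: "0 \<le> p" and ab: "0 \<le> a" "0 \<le> b" and r: "0 < r"
  shows "integrable lebesgue (\<lambda>x. indicat_real {- (pi * r)..pi * r} x *
     (norm (f x - trig_sum c n (of_real (x / r))) powr p * scaled_weight a b r x))"
proof -
  obtain t0 :: real where t0: "\<And>t::real. norm (trig_sum c n (of_real t)) \<le> norm (trig_sum c n (of_real t0))"
    by (rule trig_sum_attains_max) blast
  define M where "M = norm (trig_sum c n (of_real t0))"
  let ?J = "{- (pi * r)..pi * r}"
  have [measurable]: "f \<in> borel_measurable lebesgue" using f by (simp add: Lp_power_def)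
  have [measurable]: "scaled_weight a b r \<in> borel_measurable lebesgue"
    by (rule lebesgue_measurable_of_borel) measurable
  have [measurable]: "(\<lambda>x. trig_sum c n (of_real (x / r))) \<in> borel_measurable lebesgue"
    by (rule lebesgue_measurable_of_borel) (rule measurable_compose[OF _ trig_sum_measurable], measurable)
  have [measurable]: "indicat_real ?J \<in> borel_measurable lebesgue"
    by (rule borel_measurable_indicator) auto
  have "integrable lebesgue (\<lambda>x. 2 powr p * (norm (f x) powr p * power_weight a x + M powr p * (pi * r) powr (2 * a) * indicat_real ?J x))"
    using f integrable_indicator_Icc[of "- (pi * r)" "pi * r"]
    by (intro integrable_mult_right Bochner_Integration.integrable_add) (auto simp: Lp_power_def)
  then show ?thesis
  proof (rule Bochner_Integration.integrable_bound)
    show "AE x in lebesgue. norm (indicat_real ?J x * (norm (f x - trig_sum c n (of_real (x / r))) powr p * scaled_weight a b r x))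
      \<le> norm (2 powr p * (norm (f x) powr p * power_weight a x + M powr p * (pi * r) powr (2 * a) * indicat_real ?J x))"
    proof (rule AE_I2)
      fix x
      show "norm (indicat_real ?J x * (norm (f x - trig_sum c n (of_real (x / r))) powr p * scaled_weight a b r x))
      \<le> norm (2 powr p * (norm (f x) powr p * power_weight a x + M powr p * (pi * r) powr (2 * a) * indicat_real ?J x))"
      proof (cases "x \<in> ?J")
        case True
        then have x: "\<bar>x\<bar> \<le> pi * r" by auto
        let ?t = "norm (trig_sum c n (of_real (x / r)))"
        have "?t powr p \<le> M powr p" using t0[of "x / r"] p unfolding M_def by (intro powr_mono2) auto
        moreover have "power_weight a x \<le> (pi * r) powr (2 * a)"
          unfolding power_weight_def using x ab by (intro powr_mono2) auto
        ultimately have 1: "?t powr p * power_weight a x \<le> M powr p * (pi * r) powr (2 * a)"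
          by (intro mult_mono power_weight_nonneg) auto
        have "norm (f x - trig_sum c n (of_real (x / r))) powr p * scaled_weight a b r x
            \<le> (2 powr p * (norm (f x) powr p + ?t powr p)) * power_weight a x"
          using p by (intro mult_mono norm_diff_powr_le scaled_weight_le ab r scaled_weight_nonneg) auto
        also have "\<dots> = 2 powr p * (norm (f x) powr p * power_weight a x + ?t powr p * power_weight a x)"
          by (simp add: algebra_simps)
        also have "\<dots> \<le> 2 powr p * (norm (f x) powr p * power_weight a x + M powr p * (pi * r) powr (2 * a))"
          using 1 by (intro mult_left_mono add_left_mono) auto
        finally show ?thesis using True
          by (simp add: scaled_weight_nonneg power_weight_nonneg abs_mult)
      qed simp
    qed
  qed measurable
qed

text \<open>
  The scaled error for the target \<open>0\<close> is the rescaled weighted integral of \<open>\<bar>T\<bar> powr p\<close>, the quantity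
  that the Nikolskii inequality needs.
\<close>

lemma trig_sum_power_integral_le:
  assumes f: "f \<in> Lp_power p a" and p: "0 \<le> p" and ab: "0 \<le> a" "0 \<le> b" and r: "0 < r"
  shows "scaled_error a b p (\<lambda>_. 0) r (\<lambda>t. trig_sum c n (of_real t)) \<le> 2 powr p *
    ((LINT x|lebesgue. norm (f x) powr p * power_weight a x) + scaled_error a b p f r (\<lambda>t. trig_sum c n (of_real t)))"
proof -
  let ?J = "{- (pi * r)..pi * r}" and ?T = "\<lambda>x. trig_sum c n (of_real (x / r))"
  have fI: "integrable lebesgue (\<lambda>x. norm (f x) powr p * power_weight a x)" using f by (simp add: Lp_power_def)
  have zero: "(\<lambda>_. 0) \<in> Lp_power p a" by (simp add: Lp_power_def)
  note I = scaled_error_integrable[OF f p ab r, of c n]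
  have "scaled_error a b p (\<lambda>_. 0) r (\<lambda>t. trig_sum c n (of_real t)) \<le>
    (LINT x|lebesgue. 2 powr p * (norm (f x) powr p * power_weight a x
       + indicat_real ?J x * (norm (f x - ?T x) powr p * scaled_weight a b r x)))"
    unfolding scaled_error_def
  proof (rule integral_mono[OF scaled_error_integrable[OF zero p ab r, of c n]])
    show "integrable lebesgue (\<lambda>x. 2 powr p * (norm (f x) powr p * power_weight a x
       + indicat_real ?J x * (norm (f x - ?T x) powr p * scaled_weight a b r x)))"
      using fI I by (intro integrable_mult_right Bochner_Integration.integrable_add)
    fix x
    have "norm (f x - (f x - ?T x)) powr p * scaled_weight a b r x
        \<le> (2 powr p * (norm (f x) powr p + norm (f x - ?T x) powr p)) * scaled_weight a b r x"
      using p by (intro mult_right_mono norm_diff_powr_le scaled_weight_nonneg)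
    also have "\<dots> = 2 powr p * (norm (f x) powr p * scaled_weight a b r x + norm (f x - ?T x) powr p * scaled_weight a b r x)"
      by (simp add: algebra_simps)
    also have "\<dots> \<le> 2 powr p * (norm (f x) powr p * power_weight a x + norm (f x - ?T x) powr p * scaled_weight a b r x)"
      using scaled_weight_le[OF ab r, of x] by (intro mult_left_mono add_right_mono) auto
    finally show "indicat_real ?J x * (norm (0 - ?T x) powr p * scaled_weight a b r x) \<le> 2 powr p * (norm (f x) powr p * power_weight a x
       + indicat_real ?J x * (norm (f x - ?T x) powr p * scaled_weight a b r x))"
      by (cases "x \<in> ?J") (simp_all add: power_weight_nonneg)
  qed
  also have "\<dots> = 2 powr p * ((LINT x|lebesgue. norm (f x) powr p * power_weight a x) + scaled_error a b p f r (\<lambda>t. trig_sum c n (of_real t)))"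
    unfolding scaled_error_def using fI I by (simp add: Bochner_Integration.integral_add)
  finally show ?thesis .
qed

text \<open>
  The Nikolskii inequality makes the rescaled polynomials \<open>\<F> i\<close> a normal family of functions of growth
  \<open>M * exp (\<sigma> * \<bar>Im z\<bar>)\<close>. The limit of a subsequence given by Montel's theorem is of type \<open>\<sigma>\<close>, and
  Fatou's lemma bounds its error; being the difference of \<open>f\<close> and this error term, it lies in the
  weighted Lebesgue class.
\<close>

lemma exp_type_limit_of_trig_polys:
  assumes f: "f \<in> Lp_power p a" and p: "1 \<le> p" and ab: "0 \<le> b" "b \<le> a" and \<sigma>: "0 < \<sigma>"
    and s: "strict_mono (s :: nat \<Rightarrow> nat)" and s1: "\<And>i. 1 \<le> s i"
    and T: "\<And>i. T i \<in> trig_polys (s i)"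
    and err: "\<And>i. scaled_error a b p f (real (s i) / \<sigma>) (T i) \<le> R"
  obtains F where "F \<in> exp_type_Lp \<sigma> p a"
    "(LINT x|lebesgue. norm (f x - F (of_real x)) powr p * power_weight a x) \<le> R"
proof -
  have a: "0 \<le> a" using ab by simp
  define r where "r = (\<lambda>i. real (s i) / \<sigma>)"
  have r: "0 < r i" for i using s1[of i] \<sigma> by (simp add: r_def)
  have "\<exists>c. \<forall>i. T i = (\<lambda>t. trig_sum (c i) (s i) (of_real t))"
    using T unfolding trig_polys_iff by (intro choice) blast
  then obtain c where c: "\<And>i. T i = (\<lambda>t. trig_sum (c i) (s i) (of_real t))" by blast
  have err': "scaled_error a b p f (r i) (\<lambda>t. trig_sum (c i) (s i) (of_real t)) \<le> R" for i
    using err[of i] unfolding c[of i] r_def by simp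
  obtain K where K: "0 < K" "\<And>n c t. n \<ge> 1 \<Longrightarrow> norm (trig_sum c n (of_real t)) powr p \<le> K * real n powr (2 * a + 1) *
    (LINT t:{-pi..pi}|lebesgue. norm (trig_sum c n (of_real t)) powr p * jacobi_weight a b t)"
    using weighted_nikolskii[OF ab, of p] p by auto
  define R' where "R' = 2 powr p * ((LINT x|lebesgue. norm (f x) powr p * power_weight a x) + R)"
  define M where "M = (K * \<sigma> powr (2 * a + 1) * R') powr (1 / p)"
  have M: "norm (trig_sum (c i) (s i) (of_real t)) \<le> M" for i t
  proof -
    let ?T = "\<lambda>t::real. trig_sum (c i) (s i) (of_real t)"
    let ?I = "LINT t:{-pi..pi}|lebesgue. norm (?T t) powr p * jacobi_weight a b t"
    have "r i powr (2 * a + 1) * ?I = scaled_error a b p (\<lambda>_. 0) (r i) ?T"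
      using scaled_error_eq[where f = "\<lambda>_. 0" and T = ?T and a = a and b = b and p = p, OF r[of i]] by simp
    also have "\<dots> \<le> 2 powr p * ((LINT x|lebesgue. norm (f x) powr p * power_weight a x)
        + scaled_error a b p f (r i) ?T)"
      using p by (intro trig_sum_power_integral_le[OF f _ a ab(1) r]) simp
    also have "\<dots> \<le> R'"
      unfolding R'_def using err'[of i] by (intro mult_left_mono add_left_mono) auto
    finally have I: "r i powr (2 * a + 1) * ?I \<le> R'" .
    have "norm (?T t) powr p \<le> K * real (s i) powr (2 * a + 1) * ?I" by (rule K(2)[OF s1])
    also have "real (s i) = \<sigma> * r i" using \<sigma> by (simp add: r_def)
    also have "K * (\<sigma> * r i) powr (2 * a + 1) * ?I = K * \<sigma> powr (2 * a + 1) * (r i powr (2 * a + 1) * ?I)"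
      using \<sigma> r[of i] by (simp add: powr_mult)
    also have "\<dots> \<le> K * \<sigma> powr (2 * a + 1) * R'"
      using I K(1) by (intro mult_left_mono) auto
    finally have "(norm (?T t) powr p) powr (1 / p) \<le> M"
      unfolding M_def using p by (intro powr_mono2) auto
    then show ?thesis using p by (simp add: powr_powr)
  qed
  have M0: "0 \<le> M" by (simp add: M_def)
  define \<F> where "\<F> = (\<lambda>i z. trig_sum (c i) (s i) (z / of_real (r i)))"
  define \<H> where "\<H> = {h. h holomorphic_on UNIV \<and> (\<forall>z. norm (h z) \<le> M * exp (\<sigma> * \<bar>Im z\<bar>))}"
  have \<F>\<H>: "\<F> i \<in> \<H>" for i
  proof -
    have "(\<lambda>z. trig_sum (c i) (s i) (z / of_real (r i))) holomorphic_on UNIV"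
      unfolding trig_sum_def using r[of i] by (intro holomorphic_intros) auto
    moreover have "norm (trig_sum (c i) (s i) (z / of_real (r i))) \<le> M * exp (\<sigma> * \<bar>Im z\<bar>)" for z
    proof -
      have "real (s i) * \<bar>Im (z / of_real (r i))\<bar> = \<sigma> * \<bar>Im z\<bar>"
        using s1[of i] \<sigma> by (simp add: r_def abs_mult)
      then show ?thesis using trig_sum_growth[of "c i" "s i" M "z / of_real (r i)", OF M] by simp
    qed
    ultimately show ?thesis unfolding \<F>_def \<H>_def by simp
  qed
  obtain F \<rho> where F_hol: "F holomorphic_on UNIV" and \<rho>: "strict_mono (\<rho> :: nat \<Rightarrow> nat)"
    and F_lim: "\<And>z. (\<lambda>i. \<F> (\<rho> i) z) \<longlonglongrightarrow> F z"
  proof (rule Montel[of UNIV \<H> \<F>])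
    show "\<exists>B. \<forall>h\<in>\<H>. \<forall>z\<in>S. norm (h z) \<le> B" if S: "compact S" for S
    proof -
      obtain Y where Y: "\<And>z. z \<in> S \<Longrightarrow> norm z \<le> Y"
        using compact_imp_bounded[OF S] by (auto simp: bounded_iff)
      have "norm (h z) \<le> M * exp (\<sigma> * Y)" if "h \<in> \<H>" "z \<in> S" for h z
      proof -
        have "\<bar>Im z\<bar> \<le> Y" using abs_Im_le_cmod[of z] Y[OF that(2)] by linarith
        then have "M * exp (\<sigma> * \<bar>Im z\<bar>) \<le> M * exp (\<sigma> * Y)" using M0 \<sigma> by (intro mult_left_mono) auto
        then show ?thesis using that(1) unfolding \<H>_def by (auto intro: order_trans)
      qed
      then show ?thesis by blast
    qed
    show "range \<F> \<subseteq> \<H>" using \<F>\<H> by blast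
  qed (auto simp: \<H>_def)
  have F_growth: "norm (F z) \<le> M * exp (\<sigma> * \<bar>Im z\<bar>)" for z
    by (rule LIMSEQ_le_const2[OF tendsto_norm[OF F_lim]]) (use \<F>\<H> in \<open>auto simp: \<H>_def\<close>)
  have F_type: "F \<in> exp_type_le \<sigma>"
    unfolding exp_type_le_def
  proof (intro CollectI conjI allI impI exI F_hol)
    fix \<epsilon> :: real and z assume \<epsilon>: "0 < \<epsilon>"
    have "\<sigma> * \<bar>Im z\<bar> \<le> (\<sigma> + \<epsilon>) * norm z"
      using \<sigma> \<epsilon> abs_Im_le_cmod[of z] by (intro mult_mono) auto
    then show "norm (F z) \<le> M * exp ((\<sigma> + \<epsilon>) * norm z)"
      using F_growth[of z] M0 by (meson exp_le_cancel_iff mult_left_mono order_trans)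
  qed
  define h where "h = (\<lambda>x. norm (f x - F (of_real x)) powr p * power_weight a x)"
  define q where "q = (\<lambda>i x. indicat_real {- (pi * r i)..pi * r i} x *
     (norm (f x - trig_sum (c i) (s i) (of_real (x / r i))) powr p * scaled_weight a b (r i) x))"
  have q_int: "integrable lebesgue (q i)" for i
    unfolding q_def using f p a ab r by (intro scaled_error_integrable) auto
  have q0: "0 \<le> q i x" for i x by (simp add: q_def scaled_weight_nonneg)
  have q_le: "integral\<^sup>L lebesgue (q i) \<le> R" for i
    using err'[of i] by (simp add: q_def scaled_error_def)
  have R0: "0 \<le> R" using q_le[of 0] scaled_error_nonneg err by (meson order_trans)
  have f_meas [measurable]: "f \<in> borel_measurable lebesgue" using f by (simp add: Lp_power_def)
  have F_meas [measurable]: "(\<lambda>x. F (of_real x)) \<in> borel_measurable lebesgue"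
    by (rule lebesgue_measurable_of_borel[OF measurable_real_restriction[OF F_hol]])
  have [measurable]: "power_weight a \<in> borel_measurable lebesgue"
    by (rule lebesgue_measurable_of_borel) measurable
  have h_meas [measurable]: "h \<in> borel_measurable lebesgue" unfolding h_def by measurable
  have h0: "0 \<le> h x" for x by (simp add: h_def power_weight_nonneg)
  have r_top: "filterlim (\<lambda>i. r (\<rho> i)) at_top sequentially"
  proof -
    have "filterlim (\<lambda>i. inverse \<sigma> * real (s (\<rho> i))) at_top sequentially"
      using \<sigma> filterlim_compose[OF filterlim_real_sequentially filterlim_subseq[OF strict_mono_o[OF s \<rho>]]]
      by (intro filterlim_tendsto_pos_mult_at_top[OF tendsto_const]) (auto simp: o_def)
    then show ?thesis by (simp add: r_def divide_inverse mult.commute)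
  qed
  have q_lim: "(\<lambda>i. q (\<rho> i) x) \<longlonglongrightarrow> h x" if x: "x \<noteq> 0" for x
  proof -
    have "(\<lambda>i. norm (f x - \<F> (\<rho> i) (of_real x)) powr p * scaled_weight a b (r (\<rho> i)) x) \<longlonglongrightarrow> h x"
      unfolding h_def using p by (intro tendsto_mult tendsto_powr' tendsto_norm tendsto_diff tendsto_const F_lim
            scaled_weight_tendsto[OF x r_top]) auto
    moreover have "\<forall>\<^sub>F i in sequentially. \<bar>x\<bar> \<le> r (\<rho> i)" using r_top by (simp add: filterlim_at_top)
    then have "\<forall>\<^sub>F i in sequentially. norm (f x - \<F> (\<rho> i) (of_real x)) powr p * scaled_weight a b (r (\<rho> i)) x = q (\<rho> i) x"
    proof eventually_elim
      case (elim i)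
      have "1 * r (\<rho> i) \<le> pi * r (\<rho> i)" using r[of "\<rho> i"] pi_gt3 by (intro mult_right_mono) auto
      then have "x \<in> {- (pi * r (\<rho> i))..pi * r (\<rho> i)}" using elim by auto
      then show ?case by (simp add: q_def \<F>_def)
    qed
    ultimately show ?thesis by (rule Lim_transform_eventually)
  qed
  have "(\<integral>\<^sup>+x. ennreal (h x) \<partial>lebesgue) \<le> (\<integral>\<^sup>+x. liminf (\<lambda>i. ennreal (q (\<rho> i) x)) \<partial>lebesgue)"
  proof (rule nn_integral_mono_AE)
    have "AE x in lebesgue. x \<noteq> (0::real)" by (rule AE_completion[OF AE_lborel_singleton])
    then show "AE x in lebesgue. ennreal (h x) \<le> liminf (\<lambda>i. ennreal (q (\<rho> i) x))"
    proof eventually_elim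
      case (elim x)
      have "(\<lambda>i. ennreal (q (\<rho> i) x)) \<longlonglongrightarrow> ennreal (h x)" by (rule tendsto_ennrealI[OF q_lim[OF elim]])
      then have "liminf (\<lambda>i. ennreal (q (\<rho> i) x)) = ennreal (h x)"
        by (rule lim_imp_Liminf[OF sequentially_bot])
      then show ?case by simp
    qed
  qed
  also have "\<dots> \<le> liminf (\<lambda>i. \<integral>\<^sup>+x. ennreal (q (\<rho> i) x) \<partial>lebesgue)"
    using q_int by (intro nn_integral_liminf measurable_compose[OF _ measurable_ennreal]) auto
  also have "\<dots> \<le> ennreal R"
  proof (rule Liminf_le)
    show "\<forall>\<^sub>F i in sequentially. (\<integral>\<^sup>+x. ennreal (q (\<rho> i) x) \<partial>lebesgue) \<le> ennreal R"
      using q_le by (simp add: nn_integral_eq_integral[OF q_int] q0 ennreal_leI)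
  qed simp
  finally have h_le: "(\<integral>\<^sup>+x. ennreal (h x) \<partial>lebesgue) \<le> ennreal R" .
  have h_int: "integrable lebesgue h"
  proof (rule integrableI_nonneg)
    show "(\<integral>\<^sup>+x. ennreal (h x) \<partial>lebesgue) < \<infinity>"
      using h_le by (rule order_le_less_trans) simp
  qed (use h0 in auto)
  have "ennreal (integral\<^sup>L lebesgue h) \<le> ennreal R"
    using h_le by (simp add: nn_integral_eq_integral[OF h_int] h0)
  then have "integral\<^sup>L lebesgue h \<le> R" using R0 by (simp add: ennreal_le_iff)
  moreover have "(\<lambda>x. f x - F (of_real x)) \<in> Lp_power p a"
    using h_int by (simp add: Lp_power_def h_def)
  then have "(\<lambda>x. F (of_real x)) \<in> Lp_power p a"
    using Lp_power_diff[OF f, of "\<lambda>x. f x - F (of_real x)"] p by simp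
  then have "F \<in> exp_type_Lp \<sigma> p a" using F_type by (simp add: exp_type_Lp_def)
  ultimately show ?thesis unfolding h_def by (intro that)
qed

lemma eventually_scaled_periodic_error_greater:
  assumes p: "1 \<le> p" and ab: "0 \<le> b" "b \<le> a" and \<sigma>: "0 < \<sigma>" and f: "f \<in> Lp_power p a"
    and R: "R < line_error \<sigma> f p a"
  shows "\<forall>\<^sub>F n in sequentially. R < (real n / \<sigma>) powr ((2 * a + 1) / p) * periodic_error n \<sigma> f p a b"
proof (rule ccontr)
  assume not: "\<not> ?thesis"
  have p0: "0 < p" using p by simp
  define E where "E = (\<lambda>n. (real n / \<sigma>) powr ((2 * a + 1) / p) * periodic_error n \<sigma> f p a b)"
  obtain R' where R': "R < R'" "R' < line_error \<sigma> f p a" using dense[OF R] by blast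
  define A where "A = {n. 1 \<le> n \<and> E n < R'}"
  have "\<exists>m\<ge>n. m \<in> A" for n
  proof -
    obtain m where "max 1 n \<le> m" "\<not> R < E m"
      using not unfolding E_def eventually_sequentially by blast
    then show ?thesis using R'(1) by (intro exI[of _ m]) (auto simp: A_def)
  qed
  then have "infinite A" by (metis finite_nat_set_iff_bounded_le not_less_eq_eq)
  then obtain s :: "nat \<Rightarrow> nat" where s: "strict_mono s" "\<And>i. s i \<in> A"
    using infinite_enumerate by blast
  have s1: "1 \<le> s i" and sE: "E (s i) < R'" for i using s(2)[of i] by (auto simp: A_def)
  have "\<forall>i. \<exists>T. T \<in> trig_polys (s i) \<and> scaled_error a b p f (real (s i) / \<sigma>) T powr (1 / p) < R'"
    using scaled_periodic_error_less_imp[OF s1 \<sigma> p0 sE[unfolded E_def]] by metis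
  then obtain T where T: "\<And>i. T i \<in> trig_polys (s i)"
    and T_less: "\<And>i. scaled_error a b p f (real (s i) / \<sigma>) (T i) powr (1 / p) < R'" by metis
  have R'0: "0 \<le> R'" using T_less[of 0] by (meson less_imp_le order_le_less_trans powr_ge_zero)
  have "scaled_error a b p f (real (s i) / \<sigma>) (T i) \<le> R' powr p" for i
  proof -
    have "(scaled_error a b p f (real (s i) / \<sigma>) (T i) powr (1 / p)) powr p \<le> R' powr p"
      using T_less[of i] p0 by (intro powr_mono2) auto
    then show ?thesis using p0 by (simp add: powr_powr scaled_error_nonneg)
  qed
  then obtain F where F: "F \<in> exp_type_Lp \<sigma> p a"
    "(LINT x|lebesgue. norm (f x - F (of_real x)) powr p * power_weight a x) \<le> R' powr p"
    using exp_type_limit_of_trig_polys[OF f p ab \<sigma> s(1) s1 T] by blast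
  have "line_error \<sigma> f p a \<le> (LINT x|lebesgue. norm (f x - F (of_real x)) powr p * power_weight a x) powr (1 / p)"
    by (rule line_error_le[OF F(1)])
  also have "\<dots> \<le> (R' powr p) powr (1 / p)"
    using F(2) p0 by (intro powr_mono2 Bochner_Integration.integral_nonneg) (auto simp: power_weight_nonneg)
  also have "\<dots> = R'" using p0 R'0 by (simp add: powr_powr)
  finally show False using R'(2) by simp
qed

theorem theorem1:
  fixes p a b \<sigma> :: real and f :: "real \<Rightarrow> complex"
  assumes "1 \<le> p" and "b \<le> a" and "0 \<le> b" and "0 < \<sigma>"
    and "f \<in> Lp_power p a"
  shows "(\<lambda>n. (real n / \<sigma>) powr ((2 * a + 1) / p) * periodic_error n \<sigma> f p a b)
           \<longlonglongrightarrow> line_error \<sigma> f p a"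
  using eventually_scaled_periodic_error_greater[OF assms(1,3,2,4,5)]
    eventually_scaled_periodic_error_less[OF assms(1,3,2,4,5)]
  by (intro order_tendstoI)

end
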